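(* Let $(X,\phi)$ be a compact metric flow without fixed points. Let $\mu\in\mathcal{M}_\phi(X)$ be a $\phi$-invariant Borel probability measure. If $Y\subset X$ and $\mu(Y)=1$, then $$h_\mu(\phi_1)\le h_{top}^B(\phi,Y).$$
   Context: A (compact metric) flow $(X,\phi)$ consists of a compact metric space $(X,d)$ and a continuous map $\phi:X\times\mathbb{R}\to X$ such that each $\phi_t:=\phi(\cdot,t)$ is a homeomorphism of $X$ and $\phi_t\circ\phi_s=\phi_{s+t}$ for all $s,t\in\mathbb{R}$. It is without fixed points if there is no $x\in X$ with $\phi_t(x)=x$ for all $t\in\mathbb{R}$. $\mathcal{M}_\phi(X)$ is the set of Borel probability measures $\mu$ on $X$ with $\mu(\phi_t(B))=\mu(B)$ for all Borel $B$ and all $t\in\mathbb{R}$. $h_\mu(\phi_1)$ is the usual (Kolmogorov–Sinai) measure-theoretic entropy of the time-one map $\phi_1$. The condition $\mu(Y)=1$ presupposes that $Y$ is $\mu$-measurable. For a closed interval $I$ containing $0$, a reparametrization on $I$ is a continuous map $\alpha:I\to\mathbb{R}$ that is a homeomorphism onto its image with $\alpha(0)=0$; $Rep(I)$ is the set of these, and $Rep[0,t]=Rep([0,t])$. For $x\in X$, $t\ge 0$, $\epsilon>0$ the reparametrization ball is $$B(x,t,\epsilon,\phi)=\{y\in X:\exists\,\alpha\in Rep[0,t]\text{ such that } d(\phi_{\alpha(s)}x,\phi_s y)<\epsilon\ \ \forall\, 0\le s\le t\}.$$ Bowen entropy: for $Z\subset X$, $s\ge 0$, $N\in\mathbb{N}$,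 $\epsilon>0$, put $\mathcal{M}^s_{N,\epsilon}(\phi,Z)=\inf\sum_i\exp(-st_i)$, where the infimum is over all finite or countable families $\{B(x_i,t_i,\epsilon,\phi)\}$ with $x_i\in X$, $t_i\ge N$ and $Z\subset\bigcup_i B(x_i,t_i,\epsilon,\phi)$. Put $\mathcal{M}^s_\epsilon(\phi,Z)=\lim_{N\to\infty}\mathcal{M}^s_{N,\epsilon}(\phi,Z)$ and $\mathcal{M}^s(\phi,Z)=\lim_{\epsilon\to0}\mathcal{M}^s_\epsilon(\phi,Z)$ (these limits exist). The Bowen entropy $h_{top}^B(\phi,Z)$ is the critical value of $s$ where $\mathcal{M}^s(\phi,Z)$ jumps from $\infty$ to $0$: $h_{top}^B(\phi,Z)=\inf\{s:\mathcal{M}^s(\phi,Z)=0\}=\sup\{s:\mathcal{M}^s(\phi,Z)=\infty\}$. *)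

theory Defs
  imports "HOL-Probability.Probability"
begin

text \<open>
  The compact metric space \<open>X\<close> is the universe of a type of class \<^class>\<open>metric_space\<close>; the flow is
  written \<open>\<phi> t x\<close> for the image of \<open>x\<close> under the time-\<open>t\<close> map.
\<close>

definition compact_metric_flow :: "(real \<Rightarrow> 'a::metric_space \<Rightarrow> 'a) \<Rightarrow> bool" where
  "compact_metric_flow \<phi> \<longleftrightarrow>
     compact (UNIV :: 'a set) \<and>
     continuous_on UNIV (\<lambda>(x, t). \<phi> t x) \<and>
     (\<forall>t. \<exists>g. homeomorphism UNIV UNIV (\<phi> t) g) \<and>
     (\<forall>s t. \<phi> t \<circ> \<phi> s = \<phi> (s + t))"

definition without_fixed_points :: "(real \<Rightarrow> 'a \<Rightarrow> 'a) \<Rightarrow> bool" where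
  "without_fixed_points \<phi> \<longleftrightarrow> \<not> (\<exists>x. \<forall>t. \<phi> t x = x)"

definition invariant_prob_measures :: "(real \<Rightarrow> 'a::metric_space \<Rightarrow> 'a) \<Rightarrow> 'a measure set" where
  "invariant_prob_measures \<phi> =
     {\<mu>. prob_space \<mu> \<and> sets \<mu> = sets borel \<and>
          (\<forall>B\<in>sets borel. \<forall>t. emeasure \<mu> (\<phi> t ` B) = emeasure \<mu> B)}"


subsection \<open>Kolmogorov--Sinai entropy\<close>

definition finite_measurable_partitions :: "'a measure \<Rightarrow> 'a set set set" where
  "finite_measurable_partitions M = {P. finite P \<and> P \<subseteq> sets M \<and> partition_on (space M) P}"

text \<open>Null cells contribute \<open>0 * ln 0 = 0\<close>.\<close>

definition partition_entropy :: "'a measure \<Rightarrow> 'a set set \<Rightarrow> real" where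
  "partition_entropy M P = - (\<Sum>A\<in>P. measure M A * ln (measure M A))"

text \<open>
  The common refinement of the preimages of \<open>P\<close> under \<open>T ^^ i\<close>, \<open>i < n\<close>: its cells are the nonempty
  sets of points with a prescribed itinerary \<open>c 0, \<dots>, c (n - 1)\<close> in \<open>P\<close>.
\<close>

definition iterated_join :: "'a measure \<Rightarrow> ('a \<Rightarrow> 'a) \<Rightarrow> 'a set set \<Rightarrow> nat \<Rightarrow> 'a set set" where
  "iterated_join M T P n =
     {{x \<in> space M. \<forall>i<n. (T ^^ i) x \<in> c i} | c. \<forall>i<n. c i \<in> P} - {{}}"

definition ks_entropy_partition :: "'a measure \<Rightarrow> ('a \<Rightarrow> 'a) \<Rightarrow> 'a set set \<Rightarrow> real" where
  "ks_entropy_partition M T P =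
     lim (\<lambda>n. partition_entropy M (iterated_join M T P n) / real n)"

definition ks_entropy :: "'a measure \<Rightarrow> ('a \<Rightarrow> 'a) \<Rightarrow> ereal" where
  "ks_entropy M T =
     (SUP P\<in>finite_measurable_partitions M. ereal (ks_entropy_partition M T P))"


subsection \<open>Bowen entropy\<close>

text \<open>
  Reparametrizations are total functions of which only the values on \<open>I\<close> matter. They may be
  decreasing.
\<close>

definition Rep :: "real set \<Rightarrow> (real \<Rightarrow> real) set" where
  "Rep I = {\<alpha>. (\<exists>g. homeomorphism I (\<alpha> ` I) \<alpha> g) \<and> \<alpha> 0 = 0}"

definition rep_ball ::
  "(real \<Rightarrow> 'a::metric_space \<Rightarrow> 'a) \<Rightarrow> 'a \<Rightarrow> real \<Rightarrow> real \<Rightarrow> 'a set" where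
  "rep_ball \<phi> x t \<epsilon> = {y. \<exists>\<alpha>\<in>Rep {0..t}. \<forall>s\<in>{0..t}. dist (\<phi> (\<alpha> s) x) (\<phi> s y) < \<epsilon>}"

text \<open>
  Finite or countable families are indexed by an arbitrary \<open>I :: nat set\<close>.
\<close>

definition bowen_pre ::
  "(real \<Rightarrow> 'a::metric_space \<Rightarrow> 'a) \<Rightarrow> 'a set \<Rightarrow> real \<Rightarrow> nat \<Rightarrow> real \<Rightarrow> ennreal" where
  "bowen_pre \<phi> Z s N \<epsilon> =
     Inf {(\<Sum>\<^sub>\<infinity>i\<in>I. ennreal (exp (- s * t i))) | (I :: nat set) x t.
            (\<forall>i\<in>I. real N \<le> t i) \<and> Z \<subseteq> (\<Union>i\<in>I. rep_ball \<phi> (x i) (t i) \<epsilon>)}"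

definition bowen_eps ::
  "(real \<Rightarrow> 'a::metric_space \<Rightarrow> 'a) \<Rightarrow> 'a set \<Rightarrow> real \<Rightarrow> real \<Rightarrow> ennreal" where
  "bowen_eps \<phi> Z s \<epsilon> = lim (\<lambda>N. bowen_pre \<phi> Z s N \<epsilon>)"

definition bowen_outer ::
  "(real \<Rightarrow> 'a::metric_space \<Rightarrow> 'a) \<Rightarrow> 'a set \<Rightarrow> real \<Rightarrow> ennreal" where
  "bowen_outer \<phi> Z s = Lim (at_right 0) (\<lambda>\<epsilon>. bowen_eps \<phi> Z s \<epsilon>)"

text \<open>The value is \<open>\<infinity>\<close> if no \<open>s\<close> has vanishing \<^const>\<open>bowen_outer\<close>.\<close>

definition bowen_entropy :: "(real \<Rightarrow> 'a::metric_space \<Rightarrow> 'a) \<Rightarrow> 'a set \<Rightarrow> ereal" where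
  "bowen_entropy \<phi> Z = Inf {ereal s | s. 0 \<le> s \<and> bowen_outer \<phi> Z s = 0}"

end

theory Submission
  imports Defs
begin

text \<open>
  A cover of \<open>Y\<close> by reparametrization balls \<open>B(x\<^sub>i, t\<^sub>i, \<epsilon>)\<close> with \<open>\<Sum> exp (-s t\<^sub>i)\<close> small is turned into a
  code for itineraries: cut an orbit greedily into pieces lying in such balls, and charge \<open>s t\<^sub>i\<close> for
  naming the \<open>i\<close>-th ball. Since there are no fixed points, the reparametrization drifts by less than
  \<open>\<eta>\<close> over any time span \<open>m\<close>, so naming one of three grid shifts per block of length \<open>m\<close> recovers the
  orbit up to \<open>\<rho>\<close>, at cost \<open>ln 3 / m\<close> per unit time. The recovered orbit in turn determines the cells
  visited, except when the orbit leaves a union of separated compact cores of the cells; these visits,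
  and those to points outside finitely many of the balls, have small frequency by invariance of \<open>\<mu>\<close>.
  Gibbs' inequality bounds the entropy of the itineraries of length \<open>n\<close> by the mean code length, which
  is at most \<open>(s + o(1)) n\<close>. Neither ergodicity nor the Shannon--McMillan--Breiman theorem is used.
\<close>

section \<open>Codes for itineraries and entropy\<close>

text \<open>The obstacle is timing: the drift estimate holds only over a fixed time span, so along a
  ball of long duration the total drift need not stay bounded. It is overcome by the order of the
  choices. Given \<gamma>, the price \<open>D\<close> of an exceptional time step and the block
  length \<open>m\<close> come first; then the cores and the scale \<rho>, with the measure outside
  the cores below a bound that may depend on \<open>D\<close>; and only then the radius \<epsilon>,
  which may depend on \<open>m\<close> and \<rho>. The drift estimate is restarted in every block,
  so \<epsilon> does not depend on the number of blocks. All costs are written as Birkhoff sums of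
  one function up to a bounded error: such sums add exactly when codewords are concatenated, and
  invariance of the measure computes their mean.\<close>

lemma subadditive_convergent:
  fixes a :: "nat \<Rightarrow> real"
  assumes sub: "\<And>m n. a (m + n) \<le> a m + a n" and nonneg: "\<And>n. 0 \<le> a n"
  shows "convergent (\<lambda>n. a n / real n)"
proof -
  define S where "S = (\<lambda>n. a n / real n) ` {1..}"
  define L where "L = Inf S"
  have S_ne: "S \<noteq> {}" by (auto simp: S_def)
  have S_bdd: "bdd_below S"
    by (rule bdd_belowI[of _ 0]) (auto simp: S_def nonneg)
  have lower: "L \<le> a n / real n" if "n \<ge> 1" for n
    unfolding L_def using that S_bdd by (intro cInf_lower) (auto simp: S_def)
  \<comment> \<open>Fekete's argument: with \<open>n = q * k + r\<close> the remainder adds at most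
    a constant \<open>C\<close>, which vanishes after division by \<open>n\<close>.\<close>
  have mult: "a (q * k + r) \<le> real q * a k + a r" for q k r
  proof (induction q)
    case (Suc q)
    have "a (Suc q * k + r) = a (k + (q * k + r))" by (simp add: algebra_simps)
    also have "\<dots> \<le> a k + a (q * k + r)" by (rule sub)
    finally show ?case using Suc by (simp add: algebra_simps)
  qed simp
  have "(\<lambda>n. a n / real n) \<longlonglongrightarrow> L"
  proof (rule LIMSEQ_I)
    fix e :: real assume e: "0 < e"
    have "\<exists>x\<in>S. x < L + e / 2"
      using cInf_less_iff[OF S_ne S_bdd, of "L + e / 2"] e by (auto simp: L_def)
    then obtain k where k: "k \<ge> 1" "a k / real k < L + e / 2" by (auto simp: S_def)
    define C where "C = Max (a ` {..<k})"
    have C: "a r \<le> C" if "r < k" for r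
      unfolding C_def using that by (intro Max_ge) auto
    have C0: "0 \<le> C" using C[of 0] k(1) nonneg[of 0] by linarith
    obtain N :: nat where N: "2 * C / e < real N" using reals_Archimedean2 by blast
    have "norm (a n / real n - L) < e" if n: "n \<ge> Suc N" for n
    proof -
      have n0: "0 < real n" using n by auto
      have CN: "C / real n < e / 2"
      proof -
        have "2 * C < e * real N" using N e by (simp add: field_simps)
        also have "\<dots> \<le> e * real n" using n e by simp
        finally show ?thesis using n0 by (simp add: field_simps)
      qed
      define q r where "q = n div k" and "r = n mod k"
      have nqr: "n = q * k + r" by (simp add: q_def r_def)
      have "a n \<le> real q * a k + a r" using mult[of q k r] nqr by simp
      also have "a r \<le> C" using C[of r] k(1) by (simp add: r_def)
      also have "real q * a k = real (q * k) * (a k / real k)" using k(1) by simp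
      also have "\<dots> \<le> real n * (a k / real k)"
        using nqr nonneg[of k] by (intro mult_right_mono) auto
      finally have "a n / real n \<le> (real n * (a k / real k) + C) / real n"
        using n0 by (intro divide_right_mono) auto
      also have "\<dots> = a k / real k + C / real n" using n0 by (simp add: add_divide_distrib)
      finally have "a n / real n < L + e" using CN k(2) by linarith
      moreover have "L \<le> a n / real n" using n by (intro lower) auto
      ultimately show ?thesis by simp
    qed
    then show "\<exists>no. \<forall>n\<ge>no. norm (a n / real n - L) < e" by blast
  qed
  then show ?thesis by (rule convergentI)
qed

locale partitioned_system = prob_space M for M :: "'a measure" +
  fixes T :: "'a \<Rightarrow> 'a" and P :: "'a set set"
  assumes T_measurable [measurable]: "T \<in> measurable M M"
    and T_preserves: "distr M M T = M"
    and partition: "P \<in> finite_measurable_partitions M"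
begin

definition cell :: "'a \<Rightarrow> 'a set" where
  "cell y = (THE A. A \<in> P \<and> y \<in> A)"

primrec itin :: "nat \<Rightarrow> 'a \<Rightarrow> 'a set list" where
  "itin 0 y = []"
| "itin (Suc n) y = cell y # itin n (T y)"

text \<open>Words with empty cylinder are included, so that the words of length \<open>n + m\<close>
  form a full product and sums over them factor.\<close>

definition names :: "nat \<Rightarrow> 'a set list set" where
  "names n = {u. set u \<subseteq> P \<and> length u = n}"

definition cyl :: "'a set list \<Rightarrow> 'a set" where
  "cyl u = {x \<in> space M. itin (length u) x = u}"

definition birkhoff :: "nat \<Rightarrow> ('a \<Rightarrow> real) \<Rightarrow> 'a \<Rightarrow> real" where
  "birkhoff n g y = (\<Sum>j<n. g ((T ^^ j) y))"

text \<open>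
  The sub-probability \<open>q\<close> stands for a prefix code by Kraft's inequality: \<open>- ln (q u)\<close> is the length of
  the codeword of \<open>u\<close>, and \<open>c y\<close> bounds the cost of the itinerary of \<open>y\<close>.
\<close>

definition codable :: "nat \<Rightarrow> 'a set \<Rightarrow> ('a \<Rightarrow> real) \<Rightarrow> bool" where
  "codable n A c \<longleftrightarrow>
     (\<exists>q. (\<forall>u. 0 \<le> q u) \<and> sum q (names n) \<le> 1 \<and> (\<forall>y\<in>A. exp (- c y) \<le> q (itin n y)))"

abbreviation block_entropy :: "nat \<Rightarrow> real" where
  "block_entropy n \<equiv> partition_entropy M (iterated_join M T P n)"

section \<open>Words over the partition and their cylinders\<close>

lemma finite_P [simp]: "finite P"
  and P_sets: "A \<in> P \<Longrightarrow> A \<in> sets M"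
  and P_partition: "partition_on (space M) P"
  using partition by (auto simp: finite_measurable_partitions_def)

lemma cell_eq: "A \<in> P \<Longrightarrow> y \<in> A \<Longrightarrow> cell y = A"
  unfolding cell_def using P_partition
  by (intro the_equality) (auto simp: partition_on_def disjoint_def)

lemma cell_in: "y \<in> space M \<Longrightarrow> cell y \<in> P" and in_cell: "y \<in> space M \<Longrightarrow> y \<in> cell y"
proof -
  assume "y \<in> space M"
  then obtain A where "A \<in> P" "y \<in> A" using P_partition by (auto simp: partition_on_def)
  then show "cell y \<in> P" "y \<in> cell y" using cell_eq by auto
qed

lemma cell_iff: "A \<in> P \<Longrightarrow> y \<in> space M \<Longrightarrow> cell y = A \<longleftrightarrow> y \<in> A"
  using cell_eq in_cell by blast

lemma P_nonempty: "P \<noteq> {}"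
  using cell_in not_empty by blast

lemma T_space: "y \<in> space M \<Longrightarrow> T y \<in> space M"
  using measurable_space[OF T_measurable] .

lemma T_pow_measurable [measurable]: "T ^^ n \<in> measurable M M"
  by (induction n) (auto intro: measurable_comp)

lemma T_pow_space: "y \<in> space M \<Longrightarrow> (T ^^ n) y \<in> space M"
  using measurable_space[OF T_pow_measurable] .

lemma T_pow_preserves: "distr M M (T ^^ n) = M"
proof (induction n)
  case (Suc n)
  have "distr M M (T \<circ> (T ^^ n)) = distr (distr M M (T ^^ n)) M T"
    by (rule distr_distr[symmetric]) auto
  then show ?case using Suc T_preserves by (simp add: comp_def)
qed (simp add: distr_id2 id_def)

lemma itin_length [simp]: "length (itin n y) = n"
  by (induction n arbitrary: y) auto

lemma itin_add: "itin (n + m) y = itin n y @ itin m ((T ^^ n) y)"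
  by (induction n arbitrary: y) (auto simp: funpow_swap1)

lemma itin_nth: "i < n \<Longrightarrow> itin n y ! i = cell ((T ^^ i) y)"
proof (induction n arbitrary: y i)
  case (Suc n)
  then show ?case by (cases i) (auto simp: funpow_swap1)
qed simp

lemma itin_names: "y \<in> space M \<Longrightarrow> itin n y \<in> names n"
  by (induction n arbitrary: y) (auto simp: names_def cell_in T_space)

lemma finite_names [simp]: "finite (names n)"
  unfolding names_def by (rule finite_lists_length_eq) simp

lemma card_names: "card (names n) = card P ^ n"
  unfolding names_def by (rule card_lists_length_eq) simp

lemma names_length: "u \<in> names n \<Longrightarrow> length u = n"
  by (simp add: names_def)

lemma sum_names_add:
  fixes f g :: "'a set list \<Rightarrow> real"
  shows "(\<Sum>u\<in>names (n + m). f (take n u) * g (drop n u)) = sum f (names n) * sum g (names m)"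
proof -
  have "bij_betw (\<lambda>(u, v). u @ v) (names n \<times> names m) (names (n + m))"
    by (rule bij_betwI[where g = "\<lambda>u. (take n u, drop n u)"])
      (auto simp: names_def dest: in_set_takeD in_set_dropD)
  then have "(\<Sum>u\<in>names (n + m). f (take n u) * g (drop n u)) =
      (\<Sum>(u, v)\<in>names n \<times> names m. f (take n (u @ v)) * g (drop n (u @ v)))"
    by (subst sum.reindex_bij_betw[symmetric]) (auto simp: case_prod_unfold)
  also have "\<dots> = (\<Sum>(u, v)\<in>names n \<times> names m. f u * g v)"
    by (rule sum.cong) (auto simp: names_def)
  also have "\<dots> = sum f (names n) * sum g (names m)"
    by (simp add: sum_product sum.cartesian_product)
  finally show ?thesis .
qed

lemma sets_cyl [measurable]: "u \<in> names n \<Longrightarrow> cyl u \<in> sets M"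
proof (induction u arbitrary: n)
  case Nil
  have "cyl [] = space M" by (auto simp: cyl_def)
  then show ?case by simp
next
  case (Cons A u)
  then have "u \<in> names (length u)" "A \<in> P" by (auto simp: names_def)
  moreover have "cyl (A # u) = A \<inter> (T -` cyl u \<inter> space M)"
    using \<open>A \<in> P\<close> sets.sets_into_space[OF P_sets] 
    by (auto simp: cyl_def T_space dest: in_cell cell_eq)
  ultimately show ?case using Cons.IH P_sets by auto
qed

lemma sum_indicator_cyl:
  fixes f :: "'a set list \<Rightarrow> real"
  assumes "y \<in> space M"
  shows "(\<Sum>u\<in>names n. f u * indicator (cyl u) y) = f (itin n y)"
proof -
  have "(\<Sum>u\<in>names n. f u * indicator (cyl u) y) = (\<Sum>u\<in>names n. if u = itin n y then f u else 0)"
    using assms by (intro sum.cong) (auto simp: cyl_def names_def)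
  then show ?thesis using itin_names[OF assms] by simp
qed

lemma integral_itin:
  fixes f :: "'a set list \<Rightarrow> real"
  shows "integrable M (\<lambda>y. f (itin n y))"
    and "(\<integral>y. f (itin n y) \<partial>M) = (\<Sum>u\<in>names n. measure M (cyl u) * f u)"
proof -
  have int: "integrable M (\<lambda>y. f u * indicator (cyl u) y)" if "u \<in> names n" for u
    using sets_cyl[OF that] emeasure_finite[of "cyl u"]
    by (intro integrable_mult_right integrable_real_indicator) (auto simp: less_top[symmetric])
  have "integrable M (\<lambda>y. \<Sum>u\<in>names n. f u * indicator (cyl u) y)"
    using int by (rule Bochner_Integration.integrable_sum)
  moreover have cong: "integrable M (\<lambda>y. \<Sum>u\<in>names n. f u * indicator (cyl u) y) \<longleftrightarrow>
      integrable M (\<lambda>y. f (itin n y))"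
    by (intro Bochner_Integration.integrable_cong refl sum_indicator_cyl)
  ultimately show "integrable M (\<lambda>y. f (itin n y))" by simp
  have "(\<integral>y. f (itin n y) \<partial>M) = (\<integral>y. (\<Sum>u\<in>names n. f u * indicator (cyl u) y) \<partial>M)"
    by (intro Bochner_Integration.integral_cong refl sum_indicator_cyl[symmetric])
  also have "\<dots> = (\<Sum>u\<in>names n. \<integral>y. f u * indicator (cyl u) y \<partial>M)"
    using int by (rule Bochner_Integration.integral_sum)
  also have "\<dots> = (\<Sum>u\<in>names n. measure M (cyl u) * f u)"
    using sets_cyl by (intro sum.cong) (auto simp: Int_absorb2 sets.sets_into_space)
  finally show "(\<integral>y. f (itin n y) \<partial>M) = (\<Sum>u\<in>names n. measure M (cyl u) * f u)" .
qed

lemma sum_measure_cyl: "(\<Sum>u\<in>names n. measure M (cyl u)) = 1"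
  using integral_itin(2)[of "\<lambda>_. 1" n] by (simp add: prob_space)

lemma iterated_join_eq: "iterated_join M T P n = cyl ` names n - {{}}"
proof -
  have join: "{x \<in> space M. \<forall>i<n. (T ^^ i) x \<in> c i} = cyl (map c [0..<n])" if "\<forall>i<n. c i \<in> P" for c
  proof -
    have cyl: "cyl (map c [0..<n]) = {x \<in> space M. itin n x = map c [0..<n]}" by (simp add: cyl_def)
    have itin: "itin n x = map c [0..<n] \<longleftrightarrow> (\<forall>i<n. (T ^^ i) x \<in> c i)" if "x \<in> space M" for x
    proof -
      have "cell ((T ^^ i) x) = c i \<longleftrightarrow> (T ^^ i) x \<in> c i" if "i < n" for i
        using \<open>\<forall>i<n. c i \<in> P\<close> that T_pow_space[OF \<open>x \<in> space M\<close>] by (intro cell_iff) auto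
      moreover have "itin n x = map c [0..<n] \<longleftrightarrow> (\<forall>i<n. cell ((T ^^ i) x) = c i)"
        by (subst list_eq_iff_nth_eq) (simp add: itin_nth)
      ultimately show ?thesis by simp
    qed
    show ?thesis unfolding cyl by (intro Collect_cong conj_cong refl itin[symmetric])
  qed
  have map_names: "map c [0..<n] \<in> names n" if "\<forall>i<n. c i \<in> P" for c
    using that by (auto simp: names_def)
  have ex: "\<exists>c. u = map c [0..<n] \<and> (\<forall>i<n. c i \<in> P)" if "u \<in> names n" for u
    using that by (intro exI[of _ "\<lambda>i. u ! i"]) (auto simp: names_def list_eq_iff_nth_eq)
  have "{{x \<in> space M. \<forall>i<n. (T ^^ i) x \<in> c i} | c. \<forall>i<n. c i \<in> P} = cyl ` names n"
    (is "?L = _")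
  proof
    show "?L \<subseteq> cyl ` names n"
    proof
      fix A assume "A \<in> ?L"
      then obtain c where c: "A = {x \<in> space M. \<forall>i<n. (T ^^ i) x \<in> c i}" "\<forall>i<n. c i \<in> P"
        by (elim CollectE exE conjE)
      show "A \<in> cyl ` names n" unfolding c(1) join[OF c(2)] by (intro imageI map_names c(2))
    qed
    show "cyl ` names n \<subseteq> ?L"
    proof
      fix A assume "A \<in> cyl ` names n"
      then obtain u where u: "A = cyl u" "u \<in> names n" by (elim imageE)
      obtain c where uc: "u = map c [0..<n]" and c: "\<forall>i<n. c i \<in> P"
        using ex[OF u(2)] by (elim exE conjE)
      have "A = {x \<in> space M. \<forall>i<n. (T ^^ i) x \<in> c i}" unfolding u(1) uc join[OF c] by (rule refl)
      with c show "A \<in> ?L" by (intro CollectI exI[of _ c] conjI)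
    qed
  qed
  then show ?thesis unfolding iterated_join_def by simp
qed

lemma block_entropy_eq:
  "block_entropy n = (\<Sum>u\<in>names n. measure M (cyl u) * - ln (measure M (cyl u)))"
proof -
  let ?N = "{u \<in> names n. cyl u \<noteq> {}}"
  \<comment> \<open>Different words may share the empty cylinder, so words and cells of the join
    correspond only away from it.\<close>
  have "inj_on cyl ?N"
    by (rule inj_onI) (force simp: cyl_def names_def)
  moreover have "cyl ` names n - {{}} = cyl ` ?N" by auto
  ultimately have "block_entropy n = - (\<Sum>u\<in>?N. measure M (cyl u) * ln (measure M (cyl u)))"
    unfolding partition_entropy_def iterated_join_eq by (simp add: sum.reindex)
  also have "(\<Sum>u\<in>?N. measure M (cyl u) * ln (measure M (cyl u))) =
      (\<Sum>u\<in>names n. measure M (cyl u) * ln (measure M (cyl u)))"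
    by (rule sum.mono_neutral_left) auto
  finally show ?thesis by (simp add: sum_negf)
qed

section \<open>Entropy bounds from codes, and operations on codes\<close>

lemma block_entropy_nonneg: "0 \<le> block_entropy n"
  unfolding block_entropy_eq
proof (rule sum_nonneg)
  fix u
  show "0 \<le> measure M (cyl u) * - ln (measure M (cyl u))"
    by (cases "measure M (cyl u) = 0") (auto simp: mult_le_0_iff zero_less_measure_iff)
qed

text \<open>Apply \<open>ln z \<le> z - 1\<close> with \<open>z\<close> the ratio of code weight to
  cylinder measure. The corrections sum to at most 0, because the measures sum to 1 and the weights
  to at most 1.\<close>

lemma block_entropy_le:
  assumes "codable n A c" and A: "AE y in M. y \<in> A" and c: "integrable M c"
  shows "block_entropy n \<le> (\<integral>y. c y \<partial>M)"
proof -
  obtain q where q0: "\<And>u. 0 \<le> q u" and q1: "sum q (names n) \<le> 1"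
    and qA: "\<And>y. y \<in> A \<Longrightarrow> exp (- c y) \<le> q (itin n y)"
    using assms(1) by (auto simp: codable_def)
  let ?p = "\<lambda>u. measure M (cyl u)"
  have gibbs: "?p u * - ln (?p u) \<le> ?p u * - ln (q u) + q u - ?p u" if u: "u \<in> names n" for u
  proof (cases "?p u = 0")
    case False
    then have p: "0 < ?p u" by (simp add: zero_less_measure_iff)
    \<comment> \<open>\<open>A\<close> has full measure, so it meets each cylinder of positive
      measure; the code condition at such a point makes \<open>q u\<close> positive.\<close>
    have "\<exists>y\<in>cyl u. y \<in> A"
    proof (rule ccontr)
      assume "\<not> ?thesis"
      then have "AE y in M. y \<notin> cyl u" using A by (auto elim: AE_mp)
      then have "?p u = 0"
        using sets_cyl[OF u] by (subst (asm) AE_iff_measurable[of "cyl u"])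
          (auto simp: measure_def cyl_def)
      then show False using p by simp
    qed
    then obtain y where "y \<in> A" "itin n y = u" using u by (auto simp: cyl_def names_def)
    then have "exp (- c y) \<le> q u" using qA[of y] by simp
    then have q: "0 < q u" using exp_gt_zero[of "- c y"] by linarith
    have "ln (q u / ?p u) \<le> q u / ?p u - 1" using p q by (intro ln_le_minus_one) simp
    then have "?p u * (ln (q u) - ln (?p u)) \<le> ?p u * (q u / ?p u - 1)"
      using p q by (intro mult_left_mono) (auto simp: ln_div)
    then show ?thesis using p by (simp add: algebra_simps)
  qed (use q0 in simp)
  have "block_entropy n \<le> (\<Sum>u\<in>names n. ?p u * - ln (q u) + q u - ?p u)"
    unfolding block_entropy_eq using gibbs by (rule sum_mono)
  also have "\<dots> = (\<Sum>u\<in>names n. ?p u * - ln (q u)) + sum q (names n) - 1"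
    by (simp only: sum.distrib sum_subtractf sum_measure_cyl)
  also have "\<dots> \<le> (\<Sum>u\<in>names n. ?p u * - ln (q u))" using q1 by simp
  also have "\<dots> = (\<integral>y. - ln (q (itin n y)) \<partial>M)" by (rule integral_itin(2)[symmetric])
  also have "\<dots> \<le> (\<integral>y. c y \<partial>M)"
  proof (rule integral_mono_AE[OF integral_itin(1) c])
    show "AE y in M. - ln (q (itin n y)) \<le> c y"
      using A
    proof eventually_elim
      case (elim y)
      then have "ln (exp (- c y)) \<le> ln (q (itin n y))"
        using qA[of y] exp_gt_zero[of "- c y"] by (intro ln_mono) (auto intro: less_le_trans)
      then show ?case by simp
    qed
  qed
  finally show ?thesis .
qed

text \<open>Concatenation of codewords: a word split at \<open>n\<close> gets the product of two
  weights. The second cost is read at the shifted point, just as Birkhoff sums split.\<close>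

lemma codable_add:
  assumes "codable n A c" and "codable m B d"
  shows "codable (n + m) {y \<in> A. (T ^^ n) y \<in> B} (\<lambda>y. c y + d ((T ^^ n) y))"
proof -
  obtain q where q: "\<And>u. 0 \<le> q u" "sum q (names n) \<le> 1" "\<And>y. y \<in> A \<Longrightarrow> exp (- c y) \<le> q (itin n y)"
    using assms(1) by (auto simp: codable_def)
  obtain r where r: "\<And>u. 0 \<le> r u" "sum r (names m) \<le> 1" "\<And>y. y \<in> B \<Longrightarrow> exp (- d y) \<le> r (itin m y)"
    using assms(2) by (auto simp: codable_def)
  show ?thesis
    unfolding codable_def
  proof (intro exI[of _ "\<lambda>u. q (take n u) * r (drop n u)"] conjI allI ballI)
    show "(\<Sum>u\<in>names (n + m). q (take n u) * r (drop n u)) \<le> 1"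
      unfolding sum_names_add using q r by (intro mult_le_one sum_nonneg) auto
    fix y assume "y \<in> {y \<in> A. (T ^^ n) y \<in> B}"
    then have "exp (- c y) * exp (- d ((T ^^ n) y)) \<le> q (itin n y) * r (itin m ((T ^^ n) y))"
      using q r by (intro mult_mono) auto
    then show "exp (- (c y + d ((T ^^ n) y))) \<le> q (take n (itin (n + m) y)) * r (drop n (itin (n + m) y))"
      by (simp add: itin_add exp_add[symmetric])
  qed (use q r in auto)
qed

lemma codable_mono:
  assumes "codable n A c" and "\<And>y. y \<in> B \<Longrightarrow> y \<in> A \<and> c y \<le> d y"
  shows "codable n B d"
proof -
  obtain q where q: "\<And>u. 0 \<le> q u" "sum q (names n) \<le> 1" "\<And>y. y \<in> A \<Longrightarrow> exp (- c y) \<le> q (itin n y)"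
    using assms(1) by (auto simp: codable_def)
  have "exp (- d y) \<le> q (itin n y)" if "y \<in> B" for y
  proof -
    have "exp (- d y) \<le> exp (- c y)" using assms(2)[OF that] by simp
    also have "\<dots> \<le> q (itin n y)" using q assms(2)[OF that] by blast
    finally show ?thesis .
  qed
  then show ?thesis unfolding codable_def using q by blast
qed

text \<open>Announce \<open>i\<close> at cost \<open>- ln (w i)\<close>, then use the
  \<open>i\<close>-th code. The mixture dominates each of its terms, so any \<open>i\<close> with
  \<open>y \<in> A i\<close> serves and the sets may overlap.\<close>

lemma codable_mix:
  assumes "finite I" and "\<And>i. i \<in> I \<Longrightarrow> codable n (A i) (c i)"
    and w: "\<And>i. i \<in> I \<Longrightarrow> 0 < w i" "sum w I \<le> 1"
    and d: "\<And>i y. i \<in> I \<Longrightarrow> y \<in> A i \<Longrightarrow> c i y - ln (w i) \<le> d y"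
  shows "codable n (\<Union>i\<in>I. A i) d"
proof -
  have "\<forall>i\<in>I. \<exists>q. (\<forall>u. 0 \<le> q u) \<and> sum q (names n) \<le> 1 \<and> (\<forall>y\<in>A i. exp (- c i y) \<le> q (itin n y))"
    using assms(2) by (auto simp: codable_def)
  then obtain q where q: "\<And>i u. i \<in> I \<Longrightarrow> 0 \<le> q i u" "\<And>i. i \<in> I \<Longrightarrow> sum (q i) (names n) \<le> 1"
      "\<And>i y. i \<in> I \<Longrightarrow> y \<in> A i \<Longrightarrow> exp (- c i y) \<le> q i (itin n y)"
    by (metis bchoice)
  have w0: "0 \<le> w i" if "i \<in> I" for i using w(1)[OF that] by simp
  show ?thesis
    unfolding codable_def
  proof (intro exI[of _ "\<lambda>u. \<Sum>i\<in>I. w i * q i u"] conjI allI ballI)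
    show "0 \<le> (\<Sum>i\<in>I. w i * q i u)" for u using w0 q by (intro sum_nonneg) auto
    have "(\<Sum>u\<in>names n. \<Sum>i\<in>I. w i * q i u) = (\<Sum>i\<in>I. w i * sum (q i) (names n))"
      by (subst sum.swap) (simp add: sum_distrib_left)
    also have "\<dots> \<le> (\<Sum>i\<in>I. w i * 1)"
      using w0 q by (intro sum_mono mult_left_mono) auto
    finally show "(\<Sum>u\<in>names n. \<Sum>i\<in>I. w i * q i u) \<le> 1" using w by simp
    fix y assume "y \<in> (\<Union>i\<in>I. A i)"
    then obtain i where i: "i \<in> I" "y \<in> A i" by auto
    have "exp (- d y) \<le> exp (ln (w i) + - c i y)" using d[OF i] by simp
    also have "\<dots> = w i * exp (- c i y)" using w(1)[OF i(1)] by (simp add: exp_add exp_diff exp_minus field_simps)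
    also have "\<dots> \<le> w i * q i (itin n y)" using q(3)[OF i] w0[OF i(1)] by (intro mult_left_mono) auto
    also have "\<dots> \<le> (\<Sum>i\<in>I. w i * q i (itin n y))"
      using i w0 q(1) assms(1) by (intro member_le_sum) auto
    finally show "exp (- d y) \<le> (\<Sum>i\<in>I. w i * q i (itin n y))" .
  qed
qed

lemma codable_0: "(\<And>y. y \<in> A \<Longrightarrow> 0 \<le> c y) \<Longrightarrow> codable 0 A c"
  unfolding codable_def by (intro exI[of _ "\<lambda>_. 1"]) (auto simp: names_def conj_commute cong: conj_cong)

lemma codable_1:
  assumes "\<And>B. 0 \<le> \<kappa> B" "sum \<kappa> P \<le> 1" "\<And>y. y \<in> A \<Longrightarrow> exp (- c y) \<le> \<kappa> (cell y)"
  shows "codable 1 A c"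
proof -
  have "names 1 = (\<lambda>B. [B]) ` P" by (auto simp: names_def length_Suc_conv)
  then have "(\<Sum>u\<in>names 1. \<kappa> (hd u)) = sum \<kappa> P" by (simp add: sum.reindex inj_on_def)
  then show ?thesis
    unfolding codable_def using assms by (intro exI[of _ "\<lambda>u. \<kappa> (hd u)"]) auto
qed

lemma card_P_pos: "0 < real (card P)"
  using P_nonempty by (simp add: card_gt_0_iff)

lemma card_P_ge: "1 \<le> real (card P)"
  using P_nonempty by (simp add: card_gt_0_iff Suc_le_eq)

lemma codable_uniform: "codable n A (\<lambda>y. real n * ln (real (card P)))"
  unfolding codable_def
proof (intro exI[of _ "\<lambda>u. 1 / real (card P) ^ n"] conjI allI ballI)
  show "(\<Sum>u\<in>names n. 1 / real (card P) ^ n) \<le> 1" using card_P_pos by (simp add: card_names)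
  show "exp (- (real n * ln (real (card P)))) \<le> 1 / real (card P) ^ n" for y
    using card_P_pos by (simp add: exp_minus exp_of_nat_mult inverse_eq_divide)
qed simp

text \<open>The cylinder measures are themselves a code whose mean cost is exactly the block
  entropy. Concatenate two such codes and apply \<open>block_entropy_le\<close>.\<close>

lemma block_entropy_subadditive: "block_entropy (n + m) \<le> block_entropy n + block_entropy m"
proof -
  let ?p = "\<lambda>u. measure M (cyl u)"
  \<comment> \<open>Null cylinders are removed: there \<open>ln 0 = 0\<close> would make the cost 0,
    which the weight 0 does not allow.\<close>
  define A where "A n = {y \<in> space M. 0 < ?p (itin n y)}" for n
  define c where "c n y = - ln (?p (itin n y))" for n y
  have cod: "codable n (A n) (c n)" for n
    unfolding codable_def
    by (rule exI[of _ ?p]) (auto simp: sum_measure_cyl A_def c_def)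
  have sets_A: "A n \<in> sets M" for n
  proof -
    have "A n = (\<Union>u\<in>{u\<in>names n. 0 < ?p u}. cyl u)"
      using itin_names by (fastforce simp: A_def cyl_def names_length)
    then show ?thesis using sets_cyl by auto
  qed
  have AE: "AE y in M. y \<in> A n" for n
  proof -
    have "AE y in M. \<forall>u\<in>{u\<in>names n. ?p u = 0}. y \<notin> cyl u"
    proof (rule AE_finite_allI)
      fix u assume "u \<in> {u\<in>names n. ?p u = 0}"
      then show "AE y in M. y \<notin> cyl u"
        using sets_cyl[of u n] by (intro AE_not_in) (auto simp: null_sets_def emeasure_eq_measure)
    qed simp
    then show ?thesis
    proof (rule AE_mp, intro AE_I2 impI)
      fix y assume y: "y \<in> space M" "\<forall>u\<in>{u\<in>names n. ?p u = 0}. y \<notin> cyl u"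
      then have "?p (itin n y) \<noteq> 0" using itin_names[of y n] by (auto simp: cyl_def)
      then show "y \<in> A n" using y by (simp add: A_def zero_less_measure_iff)
    qed
  qed
  have AE2: "AE y in M. (T ^^ n) y \<in> A m"
  proof -
    have "AE y in distr M M (T ^^ n). y \<in> A m" unfolding T_pow_preserves by (rule AE)
    then show ?thesis by (subst (asm) AE_distr_iff) (use sets_A in auto)
  qed
  have int: "integrable M (c k)" and H: "block_entropy k = integral\<^sup>L M (c k)" for k
    using integral_itin[of "\<lambda>u. - ln (?p u)" k] unfolding c_def block_entropy_eq by simp_all
  have int2: "integrable M (\<lambda>y. c m ((T ^^ n) y))"
    and H2: "(\<integral>y. c m ((T ^^ n) y) \<partial>M) = integral\<^sup>L M (c m)"
  proof -
    have cM: "c m \<in> borel_measurable M" using int by (rule borel_measurable_integrable)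
    show "integrable M (\<lambda>y. c m ((T ^^ n) y))"
      using integrable_distr_eq[OF T_pow_measurable cM, of n] int by (simp add: T_pow_preserves)
    show "(\<integral>y. c m ((T ^^ n) y) \<partial>M) = integral\<^sup>L M (c m)"
      using integral_distr[OF T_pow_measurable cM, of n] by (simp add: T_pow_preserves)
  qed
  have "block_entropy (n + m) \<le> (\<integral>y. c n y + c m ((T ^^ n) y) \<partial>M)"
    by (rule block_entropy_le[OF codable_add[OF cod cod]]) (use AE AE2 int int2 in auto)
  then show ?thesis using int int2 H H2 by simp
qed

text \<open>The entropy is a \<open>lim\<close>, so bounds on the quotients say something about it
  only after convergence, which subadditivity provides.\<close>

lemma ks_entropy_partition_le:
  assumes "\<And>n. block_entropy n \<le> c * real n + C"
  shows "ks_entropy_partition M T P \<le> c"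
proof -
  let ?a = "\<lambda>n. block_entropy n / real n"
  have "convergent ?a"
    by (rule subadditive_convergent[OF block_entropy_subadditive block_entropy_nonneg])
  then have lim: "?a \<longlonglongrightarrow> ks_entropy_partition M T P"
    by (simp add: convergent_LIMSEQ_iff ks_entropy_partition_def)
  have "(\<lambda>n. c + C / real n) \<longlonglongrightarrow> c + 0"
    by (intro tendsto_add tendsto_const lim_const_over_n)
  moreover have "\<exists>N. \<forall>n\<ge>N. ?a n \<le> c + C / real n"
  proof (intro exI[of _ 1] allI impI)
    fix n :: nat assume "1 \<le> n"
    then show "?a n \<le> c + C / real n" using assms[of n] by (simp add: field_simps)
  qed
  ultimately show ?thesis using LIMSEQ_le[OF lim, of _ "c + 0"] by simp
qed

section \<open>Birkhoff sums and the greedy parsing of orbits\<close>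

lemma birkhoff_add: "birkhoff (n + m) g y = birkhoff n g y + birkhoff m g ((T ^^ n) y)"
proof -
  have "birkhoff (n + m) g y = birkhoff n g y + (\<Sum>j=n..<n+m. g ((T ^^ j) y))"
    unfolding birkhoff_def by (metis atLeast0LessThan le_add1 sum.atLeastLessThan_concat zero_le)
  also have "(\<Sum>j=n..<n+m. g ((T ^^ j) y)) = (\<Sum>j<m. g ((T ^^ (j + n)) y))"
    using sum.shift_bounds_nat_ivl[of "\<lambda>j. g ((T ^^ j) y)" 0 n m] by (simp add: atLeast0LessThan add.commute)
  finally show ?thesis by (simp add: birkhoff_def funpow_add)
qed

lemma birkhoff_1 [simp]: "birkhoff (Suc 0) g y = g y"
  by (simp add: birkhoff_def)

text \<open>Invariance gives every summand the same mean. This turns the small measure of an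
  exceptional set into a small mean frequency of visits.\<close>

lemma integral_birkhoff:
  assumes g: "integrable M g"
  shows "integrable M (birkhoff n g)" and "(\<integral>y. birkhoff n g y \<partial>M) = real n * (\<integral>y. g y \<partial>M)"
proof -
  have int: "integrable M (\<lambda>y. g ((T ^^ j) y))" for j
    using integrable_distr_eq[OF T_pow_measurable borel_measurable_integrable[OF g], of j] g
    by (simp add: T_pow_preserves)
  have eq: "(\<integral>y. g ((T ^^ j) y) \<partial>M) = (\<integral>y. g y \<partial>M)" for j
    using integral_distr[OF T_pow_measurable borel_measurable_integrable[OF g], of j]
    by (simp add: T_pow_preserves)
  show "integrable M (birkhoff n g)" unfolding birkhoff_def using int by auto
  show "(\<integral>y. birkhoff n g y \<partial>M) = real n * (\<integral>y. g y \<partial>M)"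
    unfolding birkhoff_def using int by (simp add: eq)
qed

text \<open>
  Parse an orbit greedily: a point of some \<open>G i\<close> is charged the index \<open>i\<close>, of weight \<open>w i\<close>, plus its
  code of length \<open>m i\<close>; any other point is charged its cell, of weight \<open>1 / (2 card P)\<close>, and one
  time step. The last, incomplete, piece only costs a constant.
\<close>

lemma codable_parse:
  fixes m :: "'i \<Rightarrow> nat" and w :: "'i \<Rightarrow> real"
  assumes I: "finite I" and m: "\<And>i. i \<in> I \<Longrightarrow> 1 \<le> m i"
    and G: "\<And>i. i \<in> I \<Longrightarrow> codable (m i) (G i) (\<lambda>y. birkhoff (m i) g y + ln (w i))"
    and w: "\<And>i. i \<in> I \<Longrightarrow> 0 < w i" "sum w I \<le> 1 / 2"
    and g0: "\<And>y. y \<in> space M \<Longrightarrow> 0 \<le> g y"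
    and g: "\<And>y. y \<in> space M \<Longrightarrow> y \<notin> (\<Union>i\<in>I. G i) \<Longrightarrow> ln (2 * real (card P)) \<le> g y"
  obtains C where "\<And>n. codable n (space M) (\<lambda>y. birkhoff n g y + C)"
proof -
  obtain L0 where L0: "\<And>i. i \<in> I \<Longrightarrow> m i \<le> L0"
    using I by (metis finite_nat_set_iff_bounded_le finite_imageI image_eqI)
  define L where "L = max 1 L0"
  have L: "1 \<le> L" "\<And>i. i \<in> I \<Longrightarrow> m i \<le> L" using L0 by (auto simp: L_def intro: le_trans max.cobounded2)
  \<comment> \<open>Cost bound for the uniform code of a word of length at most \<open>L\<close>;
    longer words have room for any piece.\<close>
  define C where "C = real L * ln (real (card P))"
  have "codable n (space M) (\<lambda>y. birkhoff n g y + C)" for n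
  proof (induction n rule: less_induct)
    case (less n)
    show ?case
    proof (cases "n \<le> L")
      case True
      show ?thesis
      proof (rule codable_mono[OF codable_uniform], intro conjI)
        fix y assume y: "y \<in> space M"
        have "0 \<le> birkhoff n g y" unfolding birkhoff_def using g0 T_pow_space[OF y] by (intro sum_nonneg) auto
        moreover have "real n * ln (real (card P)) \<le> C"
          unfolding C_def using True card_P_ge by (intro mult_right_mono) auto
        ultimately show "real n * ln (real (card P)) \<le> birkhoff n g y + C" by simp
        show "y \<in> space M" by fact
      qed
    next
      case False
      \<comment> \<open>The case \<open>None\<close> is a single step from a point in no
        \<open>G i\<close>. It gets the weight 1 / 2 left free by
        \<open>sum w I \<le> 1 / 2\<close>; with the uniform code for its cell it costs
        \<open>ln (2 * real (card P))\<close>, the bound required of \<open>g\<close>.\<close>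
      define k where "k j = (case j of None \<Rightarrow> 1 | Some i \<Rightarrow> m i)" for j
      define B where "B j = (case j of None \<Rightarrow> space M - (\<Union>i\<in>I. G i) | Some i \<Rightarrow> G i \<inter> space M)" for j
      define v where "v j = (case j of None \<Rightarrow> 1 / 2 | Some i \<Rightarrow> w i)" for j
      let ?J = "insert None (Some ` I)"
      have "codable n (\<Union>j\<in>?J. B j) (\<lambda>y. birkhoff n g y + C)"
      \<comment> \<open>The term \<open>ln (v j)\<close> is deducted in advance, since
        \<open>codable_mix\<close> adds \<open>- ln (v j)\<close> for announcing
        \<open>j\<close>.\<close>
      proof (rule codable_mix[where w = v and c = "\<lambda>j y. birkhoff n g y + C + ln (v j)"])
        show "finite ?J" using I by simp
        show "0 < v j" if "j \<in> ?J" for j using that w by (auto simp: v_def)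
        have "sum v ?J = 1 / 2 + sum w I"
          using I by (subst sum.insert) (auto simp: v_def sum.reindex)
        then show "sum v ?J \<le> 1" using w by simp
        fix j assume j: "j \<in> ?J"
        have k: "1 \<le> k j" "k j \<le> L" using j m L by (auto simp: k_def)
        have cod: "codable (k j) (B j) (\<lambda>y. birkhoff (k j) g y + ln (v j))"
        proof (cases j)
          case None
          have "codable 1 (B j) (\<lambda>y. birkhoff 1 g y + ln (v j))"
          proof (rule codable_mono[OF codable_uniform], intro conjI)
            fix y assume "y \<in> B j"
            then have "ln (2 * real (card P)) \<le> g y" using g by (simp add: B_def None)
            then show "real 1 * ln (real (card P)) \<le> birkhoff 1 g y + ln (v j)"
              using card_P_pos by (simp add: v_def None ln_mult ln_div P_nonempty)
            show "y \<in> B j" by fact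
          qed
          then show ?thesis by (simp add: k_def None)
        next
          case (Some i)
          then show ?thesis using G[of i] j
            by (auto simp: k_def B_def v_def intro: codable_mono)
        qed
        have "codable (n - k j) (space M) (\<lambda>y. birkhoff (n - k j) g y + C)"
          using k False by (intro less.IH) auto
        then have *: "codable (k j + (n - k j)) {y \<in> B j. (T ^^ k j) y \<in> space M}
            (\<lambda>y. (birkhoff (k j) g y + ln (v j)) + (birkhoff (n - k j) g ((T ^^ k j) y) + C))"
          by (rule codable_add[OF cod])
        have n: "k j + (n - k j) = n" using k False by simp
        have Bs: "B j \<subseteq> space M" by (auto simp: B_def split: option.splits)
        have split: "birkhoff n g y = birkhoff (k j) g y + birkhoff (n - k j) g ((T ^^ k j) y)" for y
          using birkhoff_add[of "k j" "n - k j" g y] n by simp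
        from * show "codable n (B j) (\<lambda>y. birkhoff n g y + C + ln (v j))"
          unfolding n by (rule codable_mono) (use Bs T_pow_space in \<open>auto simp: split\<close>)
      qed simp
      moreover have "(\<Union>j\<in>?J. B j) = space M" by (auto simp: B_def)
      ultimately show ?thesis by simp
    qed
  qed
  then show ?thesis by (rule that)
qed

end

section \<open>Approximate orbits determine itineraries cheaply\<close>

text \<open>The sets squeezed between a closed and an open set of nearly equal measure form a
  sigma-algebra containing the open sets. The open hull is carried along because complements
  exchange the two sides.\<close>

lemma closed_inner_regular:
  fixes M :: "'a::metric_space measure"
  assumes "finite_measure M" and M: "sets M = sets borel" and "B \<in> sets borel" and "0 < e"
  obtains K where "closed K" "K \<subseteq> B" "measure M (B - K) < e"
proof -
  interpret finite_measure M by fact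
  have closed_sets: "closed K \<Longrightarrow> K \<in> sets M" and open_sets: "open U \<Longrightarrow> U \<in> sets M"
    for K U :: "'a set" using M by auto
  have "B \<in> sigma_sets UNIV {S. open S}"
    using assms(3) by (simp add: borel_def)
  then have "\<forall>e>0. \<exists>K U. closed K \<and> open U \<and> K \<subseteq> B \<and> B \<subseteq> U \<and> measure M (U - K) < e"
  proof (induction rule: sigma_sets.induct)
    case (Basic V)
    then have V: "open V" by simp
    show ?case
    proof (intro allI impI)
      fix e :: real assume e: "0 < e"
      \<comment> \<open>The case \<open>V = UNIV\<close> is apart because
        \<open>infdist x {} = 0\<close> would make every \<open>K n\<close> empty.\<close>
      show "\<exists>K U. closed K \<and> open U \<and> K \<subseteq> V \<and> V \<subseteq> U \<and> measure M (U - K) < e"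
      proof (cases "V = UNIV")
        case True
        then show ?thesis using e by (intro exI[of _ UNIV]) auto
      next
        case False
        define K where "K n = {x. 1 / real (Suc n) \<le> infdist x (- V)}" for n
        have cl: "closed (K n)" for n
          unfolding K_def by (intro closed_Collect_le continuous_intros)
        have K_V: "K n \<subseteq> V" for n
        proof
          fix x assume "x \<in> K n"
          then have "1 / real (Suc n) \<le> infdist x (- V)" by (simp add: K_def)
          moreover have "0 < 1 / real (Suc n)" by simp
          ultimately have "infdist x (- V) \<noteq> 0" by linarith
          then show "x \<in> V" using infdist_zero[of x "- V"] by (rule contrapos_np) simp
        qed
        have un: "(\<Union>n. K n) = V"
        proof (intro equalityI subsetI)
          fix x assume "x \<in> V"
          then have "0 < infdist x (- V)"
            using in_closed_iff_infdist_zero[of "- V" x] V False infdist_nonneg[of x "- V"]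
            by (auto simp: closed_Compl less_le)
          then obtain n where "inverse (real (Suc n)) < infdist x (- V)"
            using reals_Archimedean by blast
          then show "x \<in> (\<Union>n. K n)" by (auto simp: K_def inverse_eq_divide intro!: exI[of _ n])
        qed (use K_V in auto)
        have "incseq K"
          unfolding K_def incseq_def
          by (auto elim!: order_trans[rotated] intro!: divide_left_mono)
        then have "(\<lambda>n. measure M (K n)) \<longlonglongrightarrow> measure M V"
          using finite_Lim_measure_incseq[of K] un cl closed_sets by auto
        then obtain n where "\<bar>measure M (K n) - measure M V\<bar> < e"
          using LIMSEQ_D[OF _ e] by (metis order_refl real_norm_def)
        then have "measure M (V - K n) < e"
          using finite_measure_Diff[OF open_sets[OF V] closed_sets[OF cl] K_V, of n] by linarith
        then show ?thesis using cl K_V V by blast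
      qed
    qed
  next
    case Empty
    show ?case by (intro allI impI exI[of _ "{}"]) auto
  next
    case (Compl B)
    show ?case
    proof (intro allI impI)
      fix e :: real assume "0 < e"
      then obtain K U where "closed K" "open U" "K \<subseteq> B" "B \<subseteq> U" "measure M (U - K) < e"
        using Compl.IH[rule_format, OF \<open>0 < e\<close>] by (elim exE conjE)
      moreover have "- K - (- U) = U - K" by auto
      ultimately show "\<exists>K U. closed K \<and> open U \<and> K \<subseteq> UNIV - B \<and> UNIV - B \<subseteq> U \<and> measure M (U - K) < e"
        by (intro exI[of _ "- U"] exI[of _ "- K"]) auto
    qed
  next
    case (Union B)
    show ?case
    proof (intro allI impI)
      fix e :: real assume e: "0 < e"
      \<comment> \<open>Half of \<open>e\<close> is divided among the countably many gaps. The other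
        half pays for passing from the union of all \<open>K i\<close>, which need not be closed, to
        a finite union.\<close>
      have "\<exists>K U. closed K \<and> open U \<and> K \<subseteq> B i \<and> B i \<subseteq> U \<and> measure M (U - K) < e / 2 * (1 / 2) ^ Suc i" for i
        using e by (intro Union.IH[rule_format]) simp
      then obtain K U where KU: "\<And>i. closed (K i)" "\<And>i. open (U i)" "\<And>i. K i \<subseteq> B i" "\<And>i. B i \<subseteq> U i"
        "\<And>i. measure M (U i - K i) < e / 2 * (1 / 2) ^ Suc i" by metis
      have Ks: "K i \<in> sets M" and Us: "U i \<in> sets M" for i using KU closed_sets open_sets by auto
      define L where "L n = (\<Union>i<n. K i)" for n
      have L: "closed (L n)" for n unfolding L_def using KU by auto
      have sm: "(\<lambda>i. e / 2 * (1 / 2) ^ Suc i) sums (e / 2)"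
        using sums_mult[OF power_half_series, of "e / 2"] by simp
      have small: "measure M (\<Union>i. U i - K i) \<le> e / 2"
      proof -
        have le: "measure M (U i - K i) \<le> e / 2 * (1 / 2) ^ Suc i" for i
          using KU(5)[of i] by (rule less_imp_le)
        have "summable (\<lambda>i. measure M (U i - K i))"
        proof (rule summable_comparison_test'[OF sums_summable[OF sm]])
          show "norm (measure M (U i - K i)) \<le> e / 2 * (1 / 2) ^ Suc i" for i
            using le[of i] by (simp only: real_norm_def abs_of_nonneg measure_nonneg)
        qed
        then have "measure M (\<Union>i. U i - K i) \<le> (\<Sum>i. measure M (U i - K i))"
          using Ks Us by (intro finite_measure_subadditive_countably) auto
        also have "\<dots> \<le> (\<Sum>i. e / 2 * (1 / 2) ^ Suc i)"
          using \<open>summable _\<close> sums_summable[OF sm] by (intro suminf_le le)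
        finally show ?thesis using sums_unique[OF sm] by simp
      qed
      have inc: "incseq L" unfolding L_def incseq_def by (auto intro: less_le_trans)
      have un: "(\<Union>n. L n) = (\<Union>i. K i)" unfolding L_def by auto
      have "(\<lambda>n. measure M (L n)) \<longlonglongrightarrow> measure M (\<Union>i. K i)"
        using finite_Lim_measure_incseq[OF _ inc] L closed_sets by (auto simp flip: un)
      then obtain n where n: "\<bar>measure M (L n) - measure M (\<Union>i. K i)\<bar> < e / 2"
        using LIMSEQ_D[of _ _ "e / 2"] e by (metis half_gt_zero order_refl real_norm_def)
      have "measure M ((\<Union>i. K i) - L n) < e / 2"
      proof -
        have "measure M ((\<Union>i. K i) - L n) = measure M (\<Union>i. K i) - measure M (L n)"
          using Ks closed_sets[OF L] by (intro finite_measure_Diff) (auto simp: L_def)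
        then show ?thesis using n by linarith
      qed
      moreover have "measure M ((\<Union>i. U i) - L n)
          \<le> measure M ((\<Union>i. U i - K i) \<union> ((\<Union>i. K i) - L n))"
        using Ks Us closed_sets[OF L] by (intro finite_measure_mono) auto
      moreover have "\<dots> \<le> measure M (\<Union>i. U i - K i) + measure M ((\<Union>i. K i) - L n)"
        using Ks Us closed_sets[OF L] by (intro measure_Un_le) auto
      ultimately have "measure M ((\<Union>i. U i) - L n) < e" using small by linarith
      moreover have "L n \<subseteq> (\<Union>i. B i)" "(\<Union>i. B i) \<subseteq> (\<Union>i. U i)" "open (\<Union>i. U i)"
        unfolding L_def using KU(2,3,4) by (blast, blast, blast)
      ultimately show "\<exists>K U. closed K \<and> open U \<and> K \<subseteq> (\<Union>i. B i) \<and> (\<Union>i. B i) \<subseteq> U \<and> measure M (U - K) < e"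
        using L by (intro exI[of _ "L n"] exI[of _ "\<Union>i. U i"]) auto
    qed
  qed
  then obtain K U where KU: "closed K" "open U" "K \<subseteq> B" "B \<subseteq> U" "measure M (U - K) < e"
    using assms(4) by meson
  have "measure M (B - K) \<le> measure M (U - K)"
    using KU closed_sets open_sets by (intro finite_measure_mono) auto
  then show ?thesis using KU that by auto
qed

lemma compact_disjoint_dist:
  fixes S T :: "'a::metric_space set"
  assumes "compact S" "compact T" "S \<inter> T = {}"
  shows "\<exists>d>0. \<forall>x\<in>S. \<forall>y\<in>T. d \<le> dist x y"
proof (cases "S \<times> T = {}")
  case True
  then show ?thesis by (intro exI[of _ 1]) auto
next
  case False
  have "continuous_on (S \<times> T) (\<lambda>p. dist (fst p) (snd p))" by (intro continuous_intros)
  then obtain p where p: "p \<in> S \<times> T" "\<forall>q\<in>S \<times> T. dist (fst p) (snd p) \<le> dist (fst q) (snd q)"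
    using continuous_attains_inf[OF compact_Times[OF assms(1,2)] False] by blast
  then have "0 < dist (fst p) (snd p)" using assms(3) by auto
  then show ?thesis using p(2) by (intro exI[of _ "dist (fst p) (snd p)"]) auto
qed

lemma finite_disjoint_compact_dist:
  fixes K :: "'i \<Rightarrow> 'a::metric_space set"
  assumes "finite I" and "\<And>i. i \<in> I \<Longrightarrow> compact (K i)"
    and "\<And>i j. i \<in> I \<Longrightarrow> j \<in> I \<Longrightarrow> i \<noteq> j \<Longrightarrow> K i \<inter> K j = {}"
  obtains d where "0 < d"
    "\<And>i j x y. i \<in> I \<Longrightarrow> j \<in> I \<Longrightarrow> i \<noteq> j \<Longrightarrow> x \<in> K i \<Longrightarrow> y \<in> K j \<Longrightarrow> d \<le> dist x y"
proof -
  have "\<exists>d>0. i \<noteq> j \<longrightarrow> (\<forall>x\<in>K i. \<forall>y\<in>K j. d \<le> dist x y)" if "i \<in> I" "j \<in> I" for i j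
    using compact_disjoint_dist[of "K i" "K j"] assms that by (cases "i = j") (auto intro: zero_less_one)
  then obtain d where d: "\<And>i j. i \<in> I \<Longrightarrow> j \<in> I \<Longrightarrow> 0 < d i j"
    "\<And>i j x y. i \<in> I \<Longrightarrow> j \<in> I \<Longrightarrow> i \<noteq> j \<Longrightarrow> x \<in> K i \<Longrightarrow> y \<in> K j \<Longrightarrow> d i j \<le> dist x y"
    by metis
  \<comment> \<open>The 1 keeps the set nonempty when \<open>I\<close> is empty.\<close>
  define D where "D = insert 1 ((\<lambda>(i, j). d i j) ` (I \<times> I))"
  have D: "finite D" "D \<noteq> {}" unfolding D_def using assms(1) by auto
  have "0 < Min D" using D d(1) by (subst Min_gr_iff) (auto simp: D_def)
  moreover have "Min D \<le> d i j" if "i \<in> I" "j \<in> I" for i j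
    using D that by (intro Min_le) (auto simp: D_def)
  ultimately show ?thesis using d(2) by (intro that[of "Min D"]) (assumption, meson order_trans)
qed

section \<open>Codes for orbits that follow a tree of pseudo-orbits\<close>

locale metric_partitioned_system = partitioned_system M T P
  for M :: "'a::metric_space measure" and T P +
  assumes space_UNIV [simp]: "space M = UNIV"
begin

lemma prob_UNIV [simp]: "prob UNIV = 1"
  using prob_space by simp

text \<open>A tree of pseudo-orbits: for a block of \<open>m\<close> steps the exact orbit of
  \<open>x\<close> is followed, then the centre jumps to a point of \<open>S x\<close>. The jumps
  will be the time shifts that absorb the drift of a reparametrization.\<close>

primrec shadow :: "('a \<Rightarrow> 'a set) \<Rightarrow> nat \<Rightarrow> real \<Rightarrow> nat \<Rightarrow> 'a \<Rightarrow> 'a set" where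
  "shadow S m \<rho> 0 x = UNIV"
| "shadow S m \<rho> (Suc k) x =
     {y. (\<forall>j<m. dist ((T ^^ j) x) ((T ^^ j) y) < \<rho>) \<and> (\<exists>x'\<in>S x. (T ^^ m) y \<in> shadow S m \<rho> k x')}"

text \<open>
  If \<open>y\<close> lies in the separated core \<open>K (cell y)\<close>, then any \<open>\<rho>\<close>-approximation of \<open>y\<close> determines its cell.
\<close>

lemma codable_near:
  assumes K: "\<And>A. A \<in> P \<Longrightarrow> K A \<subseteq> A"
    and sep: "\<And>A B x y. A \<in> P \<Longrightarrow> B \<in> P \<Longrightarrow> A \<noteq> B \<Longrightarrow> x \<in> K A \<Longrightarrow> y \<in> K B \<Longrightarrow> 2 * \<rho> \<le> dist x y"
    and \<theta>: "0 < \<theta>" "\<theta> < 1" and a: "exp (- a) \<le> 1 - \<theta>" "0 \<le> a"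
    and D: "exp (- D) \<le> \<theta> / real (card P)"
  shows "codable 1 {y. dist z y < \<rho>} (\<lambda>y. a + D * indicator (- (\<Union>A\<in>P. K A)) y)"
proof -
  \<comment> \<open>If the cores of two cells met the \<rho>-ball around \<open>z\<close>, they
    would come closer than \<open>2 * \<rho>\<close>; so at most one cell qualifies. If none does,
    the choice is arbitrary and only the second case below occurs.\<close>
  define A0 where "A0 = (SOME A. A \<in> P \<and> (\<exists>x\<in>K A. dist z x < \<rho>))"
  have A0: "cell y = A0" if "dist z y < \<rho>" "A \<in> P" "y \<in> K A" for A y
  proof -
    have "A0 \<in> P \<and> (\<exists>x\<in>K A0. dist z x < \<rho>)" unfolding A0_def by (rule someI[of _ A]) (use that in auto)
    then obtain x where x: "A0 \<in> P" "x \<in> K A0" "dist z x < \<rho>" by auto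
    have "dist x y < 2 * \<rho>" using x(3) that(1) dist_triangle3[of x y z] by linarith
    then have "A0 = A" using sep[of A0 A x y] x that by force
    then show ?thesis using cell_eq[of A y] K that by auto
  qed
  \<comment> \<open>The guess \<open>A0\<close> gets the bulk \<open>1 - \<theta>\<close> of the
    weight; the rest, spread evenly, keeps every cell nameable at cost \<open>D\<close>.\<close>
  define \<kappa> where "\<kappa> B = \<theta> / real (card P) + (if B = A0 then 1 - \<theta> else 0)" for B
  show ?thesis
  proof (rule codable_1)
    show "0 \<le> \<kappa> B" for B using \<theta> by (simp add: \<kappa>_def)
    show "sum \<kappa> P \<le> 1" using \<theta> card_P_pos by (simp add: \<kappa>_def sum.distrib)
    fix y assume y: "y \<in> {y. dist z y < \<rho>}"
    show "exp (- (a + D * indicator (- (\<Union>A\<in>P. K A)) y)) \<le> \<kappa> (cell y)"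
    proof (cases "y \<in> (\<Union>A\<in>P. K A)")
      case True
      then have "\<kappa> (cell y) = \<theta> / real (card P) + (1 - \<theta>)" using A0 y by (auto simp: \<kappa>_def)
      then show ?thesis using True a \<theta> by (simp add: add_increasing)
    next
      case False
      have "exp (- (a + D)) \<le> exp (- D)" using a by simp
      also have "\<dots> \<le> \<kappa> (cell y)" using D \<theta> by (simp add: \<kappa>_def)
      finally show ?thesis using False by simp
    qed
  qed
qed

lemma codable_orbit:
  assumes "\<And>z. codable 1 {y. dist z y < \<rho>} g"
  shows "codable n {y. \<forall>j<n. dist (z j) ((T ^^ j) y) < \<rho>} (birkhoff n g)"
proof (induction n arbitrary: z)
  case 0
  then show ?case by (intro codable_0) (simp add: birkhoff_def)
next
  case (Suc n)
  have "codable (1 + n) {y \<in> {y. dist (z 0) y < \<rho>}. (T ^^ 1) y \<in> {y. \<forall>j<n. dist (z (Suc j)) ((T ^^ j) y) < \<rho>}}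
     (\<lambda>y. g y + birkhoff n g ((T ^^ 1) y))"
    by (rule codable_add[OF assms Suc.IH])
  then have "codable (Suc n) {y \<in> {y. dist (z 0) y < \<rho>}. (T ^^ 1) y \<in> {y. \<forall>j<n. dist (z (Suc j)) ((T ^^ j) y) < \<rho>}}
     (\<lambda>y. g y + birkhoff n g ((T ^^ 1) y))" by simp
  then show ?case
  proof (rule codable_mono)
    fix y assume y: "y \<in> {y. \<forall>j<Suc n. dist (z j) ((T ^^ j) y) < \<rho>}"
    then show "y \<in> {y \<in> {y. dist (z 0) y < \<rho>}. (T ^^ 1) y \<in> {y. \<forall>j<n. dist (z (Suc j)) ((T ^^ j) y) < \<rho>}} \<and>
      g y + birkhoff n g ((T ^^ 1) y) \<le> birkhoff (Suc n) g y"
      using birkhoff_add[of 1 n g y] by (force simp: funpow_swap1)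
  qed
qed

text \<open>Along a fixed branch the centres are known and \<open>codable_orbit\<close> applies;
  announcing one of at most \<open>b\<close> successors costs \<open>ln b\<close> per block.\<close>

lemma codable_shadow:
  assumes near: "\<And>z. codable 1 {y. dist z y < \<rho>} g"
    and S: "\<And>x. finite (S x)" "\<And>x. card (S x) \<le> b" and b: "0 < b"
  shows "codable (m * k) (shadow S m \<rho> k x) (\<lambda>y. birkhoff (m * k) g y + real k * ln (real b))"
proof (induction k arbitrary: x)
  case 0
  have "codable 0 (shadow S m \<rho> 0 x) (\<lambda>y. birkhoff 0 g y)"
    by (intro codable_0) (simp add: birkhoff_def)
  then show ?case by simp
next
  case (Suc k)
  define A where "A = {y. \<forall>j<m. dist ((T ^^ j) x) ((T ^^ j) y) < \<rho>}"
  let ?B = "\<lambda>x'. {y \<in> A. (T ^^ m) y \<in> shadow S m \<rho> k x'}"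
  have "codable (m + m * k) (\<Union>x'\<in>S x. ?B x') (\<lambda>y. birkhoff (m + m * k) g y + real (Suc k) * ln (real b))"
  proof (rule codable_mix[where w = "\<lambda>_. 1 / real b" and
        c = "\<lambda>_ y. birkhoff m g y + (birkhoff (m * k) g ((T ^^ m) y) + real k * ln (real b))"])
    show "codable (m + m * k) (?B x') (\<lambda>y. birkhoff m g y + (birkhoff (m * k) g ((T ^^ m) y) + real k * ln (real b)))"
      for x'
      unfolding A_def by (rule codable_add[OF codable_orbit[OF near] Suc.IH])
    show "(\<Sum>x'\<in>S x. 1 / real b) \<le> 1" using S(2)[of x] b by simp
    show "birkhoff m g y + (birkhoff (m * k) g ((T ^^ m) y) + real k * ln (real b)) - ln (1 / real b)
      \<le> birkhoff (m + m * k) g y + real (Suc k) * ln (real b)" for y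
      using b by (simp add: birkhoff_add ln_div algebra_simps)
  qed (use S b in auto)
  moreover have "(\<Union>x'\<in>S x. ?B x') = shadow S m \<rho> (Suc k) x" by (auto simp: A_def)
  ultimately show ?case by simp
qed

end

section \<open>Reparametrization balls in flows without fixed points\<close>

locale compact_flow =
  fixes \<phi> :: "real \<Rightarrow> 'a::metric_space \<Rightarrow> 'a"
  assumes flow: "compact_metric_flow \<phi>"
begin

lemma compact_space: "compact (UNIV :: 'a set)"
  using flow by (simp add: compact_metric_flow_def)

lemma flow_add: "\<phi> t (\<phi> s x) = \<phi> (s + t) x"
proof -
  have "\<phi> t \<circ> \<phi> s = \<phi> (s + t)" using flow unfolding compact_metric_flow_def by blast
  then show ?thesis by (metis comp_apply)
qed

text \<open>By the composition law \<open>\<phi> 0\<close> fixes every point of its image, and as a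
  homeomorphism it is onto.\<close>

lemma flow_0 [simp]: "\<phi> 0 x = x"
proof -
  obtain g where "homeomorphism UNIV UNIV (\<phi> 0) g"
    using flow unfolding compact_metric_flow_def by blast
  then obtain z where "x = \<phi> 0 z" by (metis homeomorphism_image1 UNIV_I imageE)
  then show ?thesis by (simp add: flow_add)
qed

lemma flow_jointly_continuous: "continuous_on UNIV (\<lambda>(x, t). \<phi> t x)"
  using flow unfolding compact_metric_flow_def by blast

lemma flow_continuous_on: "continuous_on S (\<phi> t)"
proof -
  have "continuous_on S (\<lambda>x. (x, t))" by (intro continuous_intros)
  from continuous_on_compose2[OF flow_jointly_continuous this] show ?thesis by simp
qed

lemma flow_continuous_on_time:
  assumes "continuous_on S \<alpha>"
  shows "continuous_on S (\<lambda>s. \<phi> (\<alpha> s) x)"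
proof -
  have "continuous_on S (\<lambda>s. (x, \<alpha> s))" by (intro continuous_intros assms)
  from continuous_on_compose2[OF flow_jointly_continuous this] show ?thesis by simp
qed

lemma flow_uniform:
  assumes "0 < e"
  obtains d where "0 < d"
    "\<And>x y s t. s \<in> {a..b} \<Longrightarrow> t \<in> {a..b} \<Longrightarrow> dist x y < d \<Longrightarrow> \<bar>s - t\<bar> < d \<Longrightarrow> dist (\<phi> s x) (\<phi> t y) < e"
proof -
  have "continuous_on (UNIV \<times> {a..b}) (\<lambda>(x, t). \<phi> t x)"
    by (rule continuous_on_subset[OF flow_jointly_continuous subset_UNIV])
  then have "uniformly_continuous_on (UNIV \<times> {a..b}) (\<lambda>(x, t). \<phi> t x)"
    by (rule compact_uniformly_continuous[OF _ compact_Times[OF compact_space compact_Icc]])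
  then obtain d where d: "0 < d" "\<And>p q. p \<in> UNIV \<times> {a..b} \<Longrightarrow> q \<in> UNIV \<times> {a..b} \<Longrightarrow> dist q p < d \<Longrightarrow>
      dist (case q of (x, t) \<Rightarrow> \<phi> t x) (case p of (x, t) \<Rightarrow> \<phi> t x) < e"
    unfolding uniformly_continuous_on_def using assms by metis
  show ?thesis
  proof (rule that[of "d / 2"])
    fix x y :: 'a and s t :: real assume *: "s \<in> {a..b}" "t \<in> {a..b}" "dist x y < d / 2" "\<bar>s - t\<bar> < d / 2"
    have "dist (x, s) (y, t) \<le> dist x y + dist s t"
      unfolding dist_Pair_Pair by (rule sqrt_sum_squares_le_sum) auto
    also have "\<dots> < d" using * by (simp add: dist_real_def)
    finally show "dist (\<phi> s x) (\<phi> t y) < e" using d(2)[of "(y, t)" "(x, s)"] * by simp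
  qed (use d in simp)
qed

lemma flow_periodic: "\<phi> r x = x \<Longrightarrow> \<phi> (real k * r) x = x"
proof (induction k)
  case (Suc k)
  have "\<phi> (real (Suc k) * r) x = \<phi> r (\<phi> (real k * r) x)"
    by (simp add: flow_add algebra_simps)
  then show ?case using Suc by simp
qed simp

lemma funpow_flow: "(\<phi> 1 ^^ j) x = \<phi> (real j) x"
  by (induction j) (auto simp: flow_add algebra_simps)

text \<open>A limit of points with periods tending to \<open>0\<close> is fixed by the flow.\<close>

lemma periods_bounded_below:
  assumes "without_fixed_points \<phi>"
  obtains r0 where "0 < r0" "\<And>r x. 0 < r \<Longrightarrow> r < r0 \<Longrightarrow> \<phi> r x \<noteq> x"
proof (rule ccontr)
  assume "\<not> thesis"
  then have "\<exists>r x. 0 < r \<and> r < 1 / real (Suc n) \<and> \<phi> r x = x" for n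
    using that[of "1 / real (Suc n)"] by (auto simp del: of_nat_Suc)
  then obtain r x where r: "\<And>n. 0 < r n" "\<And>n. r n < 1 / real (Suc n)" "\<And>n. \<phi> (r n) (x n) = x n"
    by metis
  obtain l \<sigma> where \<sigma>: "strict_mono \<sigma>" "(x \<circ> \<sigma>) \<longlonglongrightarrow> l"
    using compact_imp_seq_compact[OF compact_space] unfolding seq_compact_def by (metis UNIV_I)
  have fixed: "\<phi> t l = l" if "0 \<le> t" for t
  proof (rule ccontr)
    assume "\<phi> t l \<noteq> l"
    define e where "e = dist (\<phi> t l) l / 3"
    have e: "0 < e" using \<open>\<phi> t l \<noteq> l\<close> by (simp add: e_def)
    \<comment> \<open>The window up to \<open>t + 1\<close> contains 0, \<open>t\<close> and the
      remainder \<open>u\<close> below, which is smaller than a period of length at most 1.\<close>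
    obtain d where d: "0 < d" "\<And>x y s t'. s \<in> {0..t + 1} \<Longrightarrow> t' \<in> {0..t + 1} \<Longrightarrow> dist x y < d \<Longrightarrow>
        \<bar>s - t'\<bar> < d \<Longrightarrow> dist (\<phi> s x) (\<phi> t' y) < e"
      using flow_uniform[OF e, of 0 "t + 1"] by blast
    have "0 < min d e" using d e by simp
    then obtain n1 where n1: "\<And>n. n \<ge> n1 \<Longrightarrow> dist ((x \<circ> \<sigma>) n) l < min d e"
      using \<sigma>(2) unfolding lim_sequentially by blast
    obtain n2 where n2: "inverse (real (Suc n2)) < d" using reals_Archimedean[OF d(1)] by blast
    define n where "n = \<sigma> (max n1 n2)"
    have "n2 \<le> n" using seq_suble[OF \<sigma>(1), of "max n1 n2"] by (simp add: n_def)
    have xn: "dist (x n) l < d" "dist (x n) l < e" using n1[of "max n1 n2"] by (auto simp: n_def)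
    have "1 / real (Suc n) \<le> 1 / real (Suc n2)" using \<open>n2 \<le> n\<close> by (intro divide_left_mono) auto
    then have rn: "r n < d" "r n \<le> 1"
    proof -
      have "1 / real (Suc n) \<le> 1" by simp
      then show "r n < d" "r n \<le> 1"
        using r(2)[of n] n2 \<open>1 / real (Suc n) \<le> 1 / real (Suc n2)\<close>
        unfolding inverse_eq_divide by linarith+
    qed
    \<comment> \<open>Removing whole periods leaves a time \<open>u\<close> shorter than one period,
      so \<open>\<phi> t (x n) = \<phi> u (x n)\<close> is close to \<open>x n\<close>, hence to
      \<open>l\<close>.\<close>
    define k where "k = nat \<lfloor>t / r n\<rfloor>"
    define u where "u = t - real k * r n"
    have "real k \<le> t / r n" "t / r n < real k + 1"
      using that r(1)[of n] by (auto simp: k_def)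
    then have u: "0 \<le> u" "u < r n" using r(1)[of n] by (auto simp: u_def field_simps)
    have "\<phi> t (x n) = \<phi> u (\<phi> (real k * r n) (x n))" by (simp add: flow_add u_def)
    then have eq: "\<phi> t (x n) = \<phi> u (x n)" using flow_periodic[OF r(3)[of n]] by simp
    have "dist (\<phi> t l) (\<phi> t (x n)) < e" using d(2)[of t t l "x n"] that xn d(1) by (simp add: dist_commute)
    moreover have "dist (\<phi> u (x n)) (\<phi> 0 (x n)) < e" using d(2)[of u 0 "x n" "x n"] u rn d(1) that by simp
    moreover have "dist (\<phi> t l) l \<le> dist (\<phi> t l) (\<phi> t (x n)) + dist (\<phi> t (x n)) (x n) + dist (x n) l"
      using dist_triangle[of "\<phi> t l" l "\<phi> t (x n)"] dist_triangle[of "\<phi> t (x n)" l "x n"] by linarith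
    ultimately have "dist (\<phi> t l) l < 3 * e" using xn eq by simp
    then show False by (simp add: e_def)
  qed
  have "\<phi> t l = l" for t
  proof (cases "0 \<le> t")
    case False
    then have "\<phi> t (\<phi> (- t) l) = \<phi> t l" using fixed[of "- t"] by simp
    then show ?thesis by (simp add: flow_add)
  qed (rule fixed)
  then show False using assms by (auto simp: without_fixed_points_def)
qed

text \<open>
  No monotonicity of \<open>\<alpha>\<close> is needed: \<open>\<phi> (\<alpha> s - s)\<close> moves the point \<open>\<phi> s x\<close> only slightly, so
  \<open>\<alpha> s - s\<close>, which starts at \<open>0\<close>, can never reach \<open>\<plusminus>\<eta>\<close>.
\<close>

lemma reparametrization_drift:
  assumes \<eta>: "0 < \<eta>" "\<And>x. \<phi> \<eta> x \<noteq> x"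
  obtains \<epsilon> where "0 < \<epsilon>"
    "\<And>\<alpha> x y s. continuous_on {0..b} \<alpha> \<Longrightarrow> \<alpha> 0 = 0 \<Longrightarrow> \<forall>s\<in>{0..b}. dist (\<phi> (\<alpha> s) x) (\<phi> s y) < \<epsilon> \<Longrightarrow>
       s \<in> {0..b} \<Longrightarrow> \<bar>\<alpha> s - s\<bar> < \<eta>"
proof -
  have "continuous_on UNIV (\<lambda>x. dist (\<phi> \<eta> x) x)"
    by (intro continuous_intros flow_continuous_on)
  then obtain x0 where x0: "\<forall>x. dist (\<phi> \<eta> x0) x0 \<le> dist (\<phi> \<eta> x) x"
    using continuous_attains_inf[OF compact_space, of "\<lambda>x. dist (\<phi> \<eta> x) x"] by auto
  \<comment> \<open>By compactness the time-\<eta> map, and with it its inverse, moves every point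
    by at least \<delta>.\<close>
  define \<delta> where "\<delta> = dist (\<phi> \<eta> x0) x0"
  have \<delta>: "0 < \<delta>" "\<delta> \<le> dist (\<phi> \<eta> x) x" for x using \<eta>(2)[of x0] x0 by (auto simp: \<delta>_def)
  have \<delta>2: "\<delta> \<le> dist (\<phi> (- \<eta>) x) x" for x
    using \<delta>(2)[of "\<phi> (- \<eta>) x"] by (simp add: flow_add dist_commute)
  have "0 < \<delta> / 2" using \<delta> by simp
  \<comment> \<open>Points closer than \<open>d\<close> at time 0 stay \<delta> / 2 close up to time
    \<open>b\<close>, so the orbit of \<open>y\<close> can be traded for that of \<open>x\<close>.
    Here the radius comes to depend on \<open>b\<close>.\<close>
  then obtain d where d: "0 < d" "\<And>x y s t. s \<in> {0..b} \<Longrightarrow> t \<in> {0..b} \<Longrightarrow> dist x y < d \<Longrightarrow>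
      \<bar>s - t\<bar> < d \<Longrightarrow> dist (\<phi> s x) (\<phi> t y) < \<delta> / 2"
    using flow_uniform by blast
  show ?thesis
  proof (rule that[of "min d (\<delta> / 2)"])
    show "0 < min d (\<delta> / 2)" using d \<delta> by simp
    fix \<alpha> x y s
    assume \<alpha>: "continuous_on {0..b} \<alpha>" "\<alpha> 0 = 0"
      and sh: "\<forall>s\<in>{0..b}. dist (\<phi> (\<alpha> s) x) (\<phi> s y) < min d (\<delta> / 2)" and s: "s \<in> {0..b}"
    have ne: "\<bar>\<alpha> u - u\<bar> \<noteq> \<eta>" if u: "u \<in> {0..b}" for u
    proof
      assume *: "\<bar>\<alpha> u - u\<bar> = \<eta>"
      have "dist x y < d" using bspec[OF sh, of 0] u \<alpha> by simp
      then have "dist (\<phi> u x) (\<phi> u y) < \<delta> / 2" using d u by simp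
      moreover have "dist (\<phi> (\<alpha> u) x) (\<phi> u y) < \<delta> / 2" using bspec[OF sh u] by simp
      ultimately have "dist (\<phi> (\<alpha> u) x) (\<phi> u x) < \<delta>"
        using dist_triangle2[of "\<phi> (\<alpha> u) x" "\<phi> u x" "\<phi> u y"] by linarith
      then have "dist (\<phi> (\<alpha> u - u) (\<phi> u x)) (\<phi> u x) < \<delta>" by (simp add: flow_add)
      then show False using * \<delta>(2)[of "\<phi> u x"] \<delta>2[of "\<phi> u x"] by (cases "0 \<le> \<alpha> u - u") auto
    qed
    show "\<bar>\<alpha> s - s\<bar> < \<eta>"
    proof (rule ccontr)
      assume "\<not> ?thesis"
      moreover have "continuous_on {0..s} (\<lambda>u. \<bar>\<alpha> u - u\<bar>)"
        using s by (intro continuous_intros continuous_on_subset[OF \<alpha>(1)]) auto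
      ultimately obtain u where u: "0 \<le> u" "u \<le> s" "\<bar>\<alpha> u - u\<bar> = \<eta>"
        using IVT'[of "\<lambda>u. \<bar>\<alpha> u - u\<bar>" 0 \<eta> s] s \<alpha> \<eta>(1) by auto
      then show False using ne[of u] s by simp
    qed
  qed
qed

text \<open>The strict inequality has room to spare on a compact time interval, so the same \<alpha>
  serves all nearby points. Openness makes the balls measurable.\<close>

lemma open_rep_ball:
  assumes "0 \<le> t"
  shows "open (rep_ball \<phi> x t \<epsilon>)"
  unfolding open_dist
proof
  fix y assume "y \<in> rep_ball \<phi> x t \<epsilon>"
  then obtain \<alpha> where \<alpha>: "\<alpha> \<in> Rep {0..t}" "\<And>s. s \<in> {0..t} \<Longrightarrow> dist (\<phi> (\<alpha> s) x) (\<phi> s y) < \<epsilon>"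
    by (auto simp: rep_ball_def)
  have "continuous_on {0..t} \<alpha>" using \<alpha>(1) by (auto simp: Rep_def homeomorphism_def)
  then have "continuous_on {0..t} (\<lambda>s. dist (\<phi> (\<alpha> s) x) (\<phi> s y))"
    by (intro continuous_intros flow_continuous_on_time) auto
  then obtain u where u: "u \<in> {0..t}"
    "\<And>s. s \<in> {0..t} \<Longrightarrow> dist (\<phi> (\<alpha> s) x) (\<phi> s y) \<le> dist (\<phi> (\<alpha> u) x) (\<phi> u y)"
    using continuous_attains_sup[of "{0..t}" "\<lambda>s. dist (\<phi> (\<alpha> s) x) (\<phi> s y)"] assms by auto
  define e where "e = \<epsilon> - dist (\<phi> (\<alpha> u) x) (\<phi> u y)"
  have "0 < e" using \<alpha>(2)[OF u(1)] by (simp add: e_def)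
  then obtain d where d: "0 < d" "\<And>x y s r. s \<in> {0..t} \<Longrightarrow> r \<in> {0..t} \<Longrightarrow> dist x y < d \<Longrightarrow>
      \<bar>s - r\<bar> < d \<Longrightarrow> dist (\<phi> s x) (\<phi> r y) < e"
    using flow_uniform by blast
  have "y' \<in> rep_ball \<phi> x t \<epsilon>" if y': "dist y' y < d" for y'
  proof -
    have "dist (\<phi> (\<alpha> s) x) (\<phi> s y') < \<epsilon>" if s: "s \<in> {0..t}" for s
    proof -
      have "dist (\<phi> s y') (\<phi> s y) < e" using d s y' by simp
      then show ?thesis
        using u(2)[OF s] dist_triangle2[of "\<phi> (\<alpha> s) x" "\<phi> s y'" "\<phi> s y"] by (simp add: e_def)
    qed
    then show ?thesis unfolding rep_ball_def using \<alpha>(1) by blast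
  qed
  then show "\<exists>e>0. \<forall>y'. dist y' y < e \<longrightarrow> y' \<in> rep_ball \<phi> x t \<epsilon>" using d(1) by blast
qed

end

text \<open>
  The drift of the reparametrization is tracked on the grid of mesh \<open>\<eta>\<close>; \<open>1 / \<eta>\<close> is an integer so
  that each block of length \<open>m\<close> changes the grid index by \<open>m / \<eta>\<close> up to at most \<open>1\<close>.
\<close>

lemma (in metric_partitioned_system) rep_ball_subset_shadow:
  fixes \<phi> :: "real \<Rightarrow> 'a \<Rightarrow> 'a"
  assumes "compact_metric_flow \<phi>" and "without_fixed_points \<phi>" and T: "T = \<phi> 1" and \<rho>: "0 < \<rho>"
  shows "\<exists>\<eta> \<epsilon>. 0 < \<epsilon> \<and> (\<forall>x t k. real (m * k) \<le> t \<longrightarrow> rep_ball \<phi> x t \<epsilon> \<subseteq>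
       shadow (\<lambda>x. (\<lambda>b. \<phi> (real m + b * \<eta>) x) ` {-1, 0, 1}) m \<rho> k x)"
proof -
  interpret compact_flow \<phi> by unfold_locales fact
  obtain r0 where r0: "0 < r0" "\<And>r x. 0 < r \<Longrightarrow> r < r0 \<Longrightarrow> \<phi> r x \<noteq> x"
    using periods_bounded_below[OF assms(2)] by blast
  have "0 < \<rho> / 2" using \<rho> by simp
  then obtain d where d: "0 < d" "\<And>x y s t. s \<in> {-1..1} \<Longrightarrow> t \<in> {-1..1} \<Longrightarrow> dist x y < d \<Longrightarrow>
      \<bar>s - t\<bar> < d \<Longrightarrow> dist (\<phi> s x) (\<phi> t y) < \<rho> / 2"
    using flow_uniform[of "\<rho> / 2" "-1" 1] by blast
  \<comment> \<open>\<open>r0\<close> makes the time-\<eta> map free of fixed points,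
    \<open>1 / 2\<close> keeps time errors below \<open>2 * \<eta>\<close> inside the window
    \<open>{-1..1}\<close>, and \<open>d / 2\<close> makes such errors displace points by less than
    \<rho> / 2.\<close>
  have "0 < min r0 (min (1 / 2) (d / 2))" using r0 d by simp
  then obtain M0 where M0: "inverse (real (Suc M0)) < min r0 (min (1 / 2) (d / 2))"
    using reals_Archimedean by blast
  define \<eta> where "\<eta> = inverse (real (Suc M0))"
  have \<eta>: "0 < \<eta>" "\<eta> < r0" "2 * \<eta> < 1" "2 * \<eta> < d" using M0 by (auto simp: \<eta>_def)
  obtain \<epsilon>0 where \<epsilon>0: "0 < \<epsilon>0" and drift: "\<And>\<alpha> x y s. continuous_on {0..real m} \<alpha> \<Longrightarrow> \<alpha> 0 = 0 \<Longrightarrow>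
      \<forall>s\<in>{0..real m}. dist (\<phi> (\<alpha> s) x) (\<phi> s y) < \<epsilon>0 \<Longrightarrow> s \<in> {0..real m} \<Longrightarrow> \<bar>\<alpha> s - s\<bar> < \<eta>"
    using reparametrization_drift[of \<eta> "real m"] \<eta> r0 by metis
  define \<epsilon> where "\<epsilon> = min \<epsilon>0 (\<rho> / 2)"
  let ?S = "\<lambda>x. (\<lambda>b. \<phi> (real m + b * \<eta>) x) ` {-1, 0, 1}"
  \<comment> \<open>For the induction \<alpha> may start anywhere: after a block it starts at
    \<open>\<alpha> (real m)\<close>, and the tree is rooted again at the last grid time not beyond
    that.\<close>
  have key: "y \<in> shadow ?S m \<rho> k (\<phi> (\<eta> * of_int \<lfloor>\<alpha> 0 / \<eta>\<rfloor>) x)"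
    if "continuous_on {0..real (m * k)} \<alpha>"
      and "\<And>s. s \<in> {0..real (m * k)} \<Longrightarrow> dist (\<phi> (\<alpha> s) x) (\<phi> s y) < \<epsilon>" for k \<alpha> x y
    using that
  proof (induction k arbitrary: \<alpha> y)
    case (Suc k)
    define z where "z = \<phi> (\<eta> * of_int \<lfloor>\<alpha> 0 / \<eta>\<rfloor>) x"
    have le: "real m \<le> real (m * Suc k)" by (simp only: of_nat_le_iff) simp
    have sub: "{0..real m} \<subseteq> {0..real (m * Suc k)}"
      using le by (simp only: atLeastatMost_subset_iff order_refl simp_thms)
    have mk: "real (m * Suc k) = real m + real (m * k)" by simp
    \<comment> \<open>Subtracting \<open>\<alpha> 0\<close> and moving the base point restarts the
      drift estimate in each block, so \<epsilon> depends on \<open>m\<close> but not on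
      \<open>k\<close>.\<close>
    have dr: "\<bar>\<alpha> s - \<alpha> 0 - s\<bar> < \<eta>" if "s \<in> {0..real m}" for s
    proof (rule drift[of "\<lambda>s. \<alpha> s - \<alpha> 0" "\<phi> (\<alpha> 0) x" y s])
      show "continuous_on {0..real m} (\<lambda>s. \<alpha> s - \<alpha> 0)"
        by (intro continuous_intros continuous_on_subset[OF Suc.prems(1) sub])
      show "\<forall>s\<in>{0..real m}. dist (\<phi> (\<alpha> s - \<alpha> 0) (\<phi> (\<alpha> 0) x)) (\<phi> s y) < \<epsilon>0"
      proof
        fix s assume "s \<in> {0..real m}"
        then have "s \<in> {0..real (m * Suc k)}" using sub by blast
        then show "dist (\<phi> (\<alpha> s - \<alpha> 0) (\<phi> (\<alpha> 0) x)) (\<phi> s y) < \<epsilon>0"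
          using Suc.prems(2)[of s] by (simp add: flow_add \<epsilon>_def)
      qed
    qed (use that in auto)
    have grid: "\<eta> * of_int \<lfloor>v / \<eta>\<rfloor> \<le> v" "v < \<eta> * of_int \<lfloor>v / \<eta>\<rfloor> + \<eta>" for v
    proof -
      have "\<eta> * of_int \<lfloor>v / \<eta>\<rfloor> \<le> \<eta> * (v / \<eta>)" "\<eta> * (v / \<eta>) < \<eta> * (of_int \<lfloor>v / \<eta>\<rfloor> + 1)"
        using \<eta>(1) by (intro mult_left_mono mult_strict_left_mono; linarith)+
      moreover have "\<eta> * (v / \<eta>) = v" using \<eta>(1) by simp
      ultimately show "\<eta> * of_int \<lfloor>v / \<eta>\<rfloor> \<le> v" "v < \<eta> * of_int \<lfloor>v / \<eta>\<rfloor> + \<eta>"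
        by (simp_all only: distrib_left mult_1_right)
    qed
    have "dist ((T ^^ j) z) ((T ^^ j) y) < \<rho>" if "j < m" for j
    proof -
      have j: "real j \<in> {0..real m}" using that by simp
      then have j': "real j \<in> {0..real (m * Suc k)}" using sub by blast
      \<comment> \<open>The nominal time: rounding \<open>\<alpha> 0\<close> to the grid and the
        drift since the block began each contribute an error below \<eta>.\<close>
      define w where "w = \<eta> * of_int \<lfloor>\<alpha> 0 / \<eta>\<rfloor> + real j"
      have "\<bar>\<alpha> (real j) - w\<bar> < 2 * \<eta>" using dr[OF j] grid[of "\<alpha> 0"] by (auto simp: w_def)
      then have "dist (\<phi> 0 (\<phi> w x)) (\<phi> (\<alpha> (real j) - w) (\<phi> w x)) < \<rho> / 2"
        using \<eta> d(1) by (intro d(2)) auto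
      moreover have "dist (\<phi> (\<alpha> (real j)) x) (\<phi> (real j) y) < \<rho> / 2"
        using Suc.prems(2)[OF j'] by (simp add: \<epsilon>_def)
      ultimately have "dist (\<phi> w x) (\<phi> (real j) y) < \<rho>"
        using dist_triangle[of "\<phi> w x" "\<phi> (real j) y" "\<phi> (\<alpha> (real j)) x"] by (simp add: flow_add)
      then show ?thesis by (simp add: T funpow_flow z_def flow_add w_def)
    qed
    moreover have "\<exists>x'\<in>?S z. (T ^^ m) y \<in> shadow ?S m \<rho> k x'"
    proof -
      \<comment> \<open>Change of the grid index minus the \<open>m * Suc M0\<close> grid steps of a
        block without drift. The drift and the difference of the two rounding errors are each below
        \<eta>, so this integer lies strictly between -2 and 2.\<close>
      let ?b = "\<lfloor>\<alpha> (real m) / \<eta>\<rfloor> - \<lfloor>\<alpha> 0 / \<eta>\<rfloor> - int (m * Suc M0)"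
      have m\<eta>: "real m = \<eta> * of_int (int (m * Suc M0))"
      proof -
        have "\<eta> * of_int (int (m * Suc M0)) = real m * (\<eta> * real (Suc M0))" by (simp add: algebra_simps)
        also have "\<eta> * real (Suc M0) = 1" unfolding \<eta>_def by (rule left_inverse) simp
        finally show ?thesis by simp
      qed
      have b\<eta>: "\<eta> * of_int ?b = \<eta> * of_int \<lfloor>\<alpha> (real m) / \<eta>\<rfloor> - \<eta> * of_int \<lfloor>\<alpha> 0 / \<eta>\<rfloor> - real m"
        using m\<eta> by (simp only: of_int_diff right_diff_distrib)
      have "\<bar>\<eta> * of_int ?b\<bar> < \<eta> * 2"
        using dr[of "real m"] grid[of "\<alpha> 0"] grid[of "\<alpha> (real m)"] b\<eta> by auto
      then have "\<eta> * \<bar>of_int ?b\<bar> < \<eta> * 2" using \<eta>(1) by (simp only: abs_mult abs_of_pos)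
      then have "\<bar>of_int ?b :: real\<bar> < 2" using \<eta>(1) by (simp only: mult_less_cancel_left_pos)
      then have "\<bar>?b\<bar> < 2" by linarith
      then have "?b = -1 \<or> ?b = 0 \<or> ?b = 1" by linarith
      then have "(of_int ?b :: real) \<in> {-1, 0, 1}"
        by (elim disjE; simp only: of_int_minus of_int_1 of_int_0 insert_iff simp_thms)
      then have "\<phi> (real m + of_int ?b * \<eta>) z \<in> ?S z" by blast
      moreover have "\<phi> (real m + of_int ?b * \<eta>) z = \<phi> (\<eta> * of_int \<lfloor>\<alpha> (real m) / \<eta>\<rfloor>) x"
      proof -
        have "\<eta> * of_int \<lfloor>\<alpha> 0 / \<eta>\<rfloor> + (real m + of_int ?b * \<eta>) = \<eta> * of_int \<lfloor>\<alpha> (real m) / \<eta>\<rfloor>"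
          unfolding mult.commute[of _ \<eta>] b\<eta> by simp
        then show ?thesis by (simp only: z_def flow_add)
      qed
      moreover have "(T ^^ m) y \<in> shadow ?S m \<rho> k (\<phi> (\<eta> * of_int \<lfloor>\<alpha> (real m) / \<eta>\<rfloor>) x)"
      proof -
        have "continuous_on {0..real (m * k)} (\<alpha> \<circ> (\<lambda>s. real m + s))"
          by (intro continuous_on_compose continuous_intros continuous_on_subset[OF Suc.prems(1)])
            (auto simp: mk)
        then have "continuous_on {0..real (m * k)} (\<lambda>s. \<alpha> (real m + s))" by (simp add: o_def)
        moreover have "dist (\<phi> (\<alpha> (real m + s)) x) (\<phi> s (\<phi> (real m) y)) < \<epsilon>"
          if "s \<in> {0..real (m * k)}" for s
          using Suc.prems(2)[of "real m + s"] that mk by (simp add: flow_add)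
        ultimately have "\<phi> (real m) y \<in> shadow ?S m \<rho> k (\<phi> (\<eta> * of_int \<lfloor>\<alpha> (real m + 0) / \<eta>\<rfloor>) x)"
          by (rule Suc.IH)
        then show ?thesis by (simp add: T funpow_flow)
      qed
      ultimately show ?thesis by metis
    qed
    ultimately show ?case unfolding z_def by simp
  qed simp
  show ?thesis
  proof (rule exI[of _ \<eta>], rule exI[of _ \<epsilon>], intro conjI allI impI)
    show "0 < \<epsilon>" using \<epsilon>0 \<rho> by (simp add: \<epsilon>_def)
    fix x t k assume t: "real (m * k) \<le> t"
    show "rep_ball \<phi> x t \<epsilon> \<subseteq> shadow ?S m \<rho> k x"
    proof
      fix y assume "y \<in> rep_ball \<phi> x t \<epsilon>"
      then obtain \<alpha> where \<alpha>: "\<alpha> \<in> Rep {0..t}" "\<And>s. s \<in> {0..t} \<Longrightarrow> dist (\<phi> (\<alpha> s) x) (\<phi> s y) < \<epsilon>"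
        by (auto simp: rep_ball_def)
      have c: "continuous_on {0..real (m * k)} \<alpha>" and "\<alpha> 0 = 0"
        using \<alpha>(1) t by (auto simp: Rep_def homeomorphism_def intro: continuous_on_subset)
      have "y \<in> shadow ?S m \<rho> k (\<phi> (\<eta> * of_int \<lfloor>\<alpha> 0 / \<eta>\<rfloor>) x)"
        using \<alpha>(2) t by (intro key c) auto
      then show "y \<in> shadow ?S m \<rho> k x" using \<open>\<alpha> 0 = 0\<close> by simp
    qed
  qed
qed

section \<open>Bowen outer measures as monotone limits, and the covers they provide\<close>

lemma bowen_pre_mono_length: "N \<le> N' \<Longrightarrow> bowen_pre \<phi> Z s N \<epsilon> \<le> bowen_pre \<phi> Z s N' \<epsilon>"
  unfolding bowen_pre_def by (rule Inf_superset_mono) (force intro: order_trans)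

lemma bowen_pre_antimono_radius: "\<epsilon> \<le> \<epsilon>' \<Longrightarrow> bowen_pre \<phi> Z s N \<epsilon>' \<le> bowen_pre \<phi> Z s N \<epsilon>"
proof -
  assume "\<epsilon> \<le> \<epsilon>'"
  then have "rep_ball \<phi> x t \<epsilon> \<subseteq> rep_ball \<phi> x t \<epsilon>'" for x t by (force simp: rep_ball_def)
  then have sub: "(\<Union>i\<in>I. rep_ball \<phi> (x i) (t i) \<epsilon>) \<subseteq> (\<Union>i\<in>I. rep_ball \<phi> (x i) (t i) \<epsilon>')"
    for I :: "nat set" and x t by (intro UN_mono order_refl)
  show ?thesis
    unfolding bowen_pre_def
  proof (rule Inf_superset_mono, rule subsetI)
    fix v
    assume "v \<in> {(\<Sum>\<^sub>\<infinity>i\<in>I. ennreal (exp (- s * t i))) | (I :: nat set) x t.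
      (\<forall>i\<in>I. real N \<le> t i) \<and> Z \<subseteq> (\<Union>i\<in>I. rep_ball \<phi> (x i) (t i) \<epsilon>)}"
    then obtain I :: "nat set" and x t where v: "v = (\<Sum>\<^sub>\<infinity>i\<in>I. ennreal (exp (- s * t i)))"
      "\<forall>i\<in>I. real N \<le> t i" "Z \<subseteq> (\<Union>i\<in>I. rep_ball \<phi> (x i) (t i) \<epsilon>)"
      by (elim CollectE exE conjE)
    show "v \<in> {(\<Sum>\<^sub>\<infinity>i\<in>I. ennreal (exp (- s * t i))) | (I :: nat set) x t.
      (\<forall>i\<in>I. real N \<le> t i) \<and> Z \<subseteq> (\<Union>i\<in>I. rep_ball \<phi> (x i) (t i) \<epsilon>')}"
      by (intro CollectI exI conjI) (rule v(1,2) subset_trans[OF v(3) sub])+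
  qed
qed

text \<open>Raising \<open>N\<close> leaves fewer families, so the sequence increases and the
  \<open>lim\<close> of the definition is a true limit.\<close>

lemma bowen_eps_eq_SUP: "bowen_eps \<phi> Z s \<epsilon> = (SUP N. bowen_pre \<phi> Z s N \<epsilon>)"
  unfolding bowen_eps_def
  by (intro limI LIMSEQ_SUP) (auto simp: incseq_def bowen_pre_mono_length)

text \<open>Shrinking the radius leaves fewer covers, so the one-sided limit exists. As a supremum,
  a vanishing \<open>bowen_outer\<close> forces every \<open>bowen_pre\<close> at positive radius to
  vanish.\<close>

lemma bowen_outer_eq_SUP: "bowen_outer \<phi> Z s = (SUP \<epsilon>\<in>{0<..}. bowen_eps \<phi> Z s \<epsilon>)"
proof -
  have anti: "bowen_eps \<phi> Z s \<epsilon>' \<le> bowen_eps \<phi> Z s \<epsilon>" if "\<epsilon> \<le> \<epsilon>'" for \<epsilon> \<epsilon>'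
    unfolding bowen_eps_eq_SUP by (intro SUP_mono' bowen_pre_antimono_radius that)
  have "((\<lambda>\<epsilon>. bowen_eps \<phi> Z s \<epsilon>) \<longlongrightarrow> (SUP \<epsilon>\<in>{0<..}. bowen_eps \<phi> Z s \<epsilon>)) (at_right 0)"
  proof (rule order_tendstoI)
    fix a assume "a < (SUP \<epsilon>\<in>{0<..}. bowen_eps \<phi> Z s \<epsilon>)"
    then obtain \<epsilon>' where \<epsilon>': "0 < \<epsilon>'" "a < bowen_eps \<phi> Z s \<epsilon>'" by (auto simp: less_SUP_iff)
    have "eventually (\<lambda>\<epsilon>. \<epsilon> < \<epsilon>') (at_right 0)" using \<epsilon>'(1) by (auto simp: eventually_at_right)
    then show "eventually (\<lambda>\<epsilon>. a < bowen_eps \<phi> Z s \<epsilon>) (at_right 0)"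
      by eventually_elim (use \<epsilon>' anti in \<open>auto intro: less_le_trans\<close>)
  next
    fix a assume a: "(SUP \<epsilon>\<in>{0<..}. bowen_eps \<phi> Z s \<epsilon>) < a"
    have "eventually (\<lambda>\<epsilon>::real. 0 < \<epsilon>) (at_right 0)" by (simp add: eventually_at_right_less)
    then show "eventually (\<lambda>\<epsilon>. bowen_eps \<phi> Z s \<epsilon> < a) (at_right 0)"
      by eventually_elim (use a in \<open>auto intro: le_less_trans[OF SUP_upper]\<close>)
  qed
  then show ?thesis unfolding bowen_outer_def by (intro tendsto_Lim) auto
qed

text \<open>The bound is put on finite partial sums, as only a finite subfamily will be
  coded.\<close>

lemma bowen_outer_zero_cover:
  assumes "bowen_outer \<phi> Z s = 0" and "0 < \<epsilon>" and "0 < e"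
  shows "\<exists>(I :: nat set) x t. (\<forall>i\<in>I. real N \<le> t i) \<and> Z \<subseteq> (\<Union>i\<in>I. rep_ball \<phi> (x i) (t i) \<epsilon>) \<and>
    (\<forall>F. finite F \<longrightarrow> F \<subseteq> I \<longrightarrow> (\<Sum>i\<in>F. exp (- s * t i)) \<le> e)"
proof -
  have "bowen_eps \<phi> Z s \<epsilon> \<le> bowen_outer \<phi> Z s"
    unfolding bowen_outer_eq_SUP using assms(2) by (intro SUP_upper) auto
  moreover have "bowen_pre \<phi> Z s N \<epsilon> \<le> bowen_eps \<phi> Z s \<epsilon>"
    unfolding bowen_eps_eq_SUP by (intro SUP_upper) auto
  ultimately have "bowen_pre \<phi> Z s N \<epsilon> < ennreal e" using assms by simp
  then obtain I :: "nat set" and x t where I: "\<forall>i\<in>I. real N \<le> t i"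
    "Z \<subseteq> (\<Union>i\<in>I. rep_ball \<phi> (x i) (t i) \<epsilon>)" "(\<Sum>\<^sub>\<infinity>i\<in>I. ennreal (exp (- s * t i))) < ennreal e"
    unfolding bowen_pre_def Inf_less_iff by auto
  have sum: "(\<Sum>i\<in>F. exp (- s * t i)) \<le> e" if F: "finite F" "F \<subseteq> I" for F
  proof -
    have "ennreal (\<Sum>i\<in>F. exp (- s * t i)) = (\<Sum>i\<in>F. ennreal (exp (- s * t i)))"
      by (rule sum_ennreal[symmetric]) simp
    also have "\<dots> \<le> (\<Sum>\<^sub>\<infinity>i\<in>I. ennreal (exp (- s * t i)))"
      using F by (subst nonneg_infsum_complete) (auto intro!: SUP_upper2[of F])
    finally have "ennreal (\<Sum>i\<in>F. exp (- s * t i)) \<le> ennreal e" using I(3) by simp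
    then show ?thesis using assms(3) by (subst (asm) ennreal_le_iff) auto
  qed
  then have "\<forall>F. finite F \<longrightarrow> F \<subseteq> I \<longrightarrow> (\<Sum>i\<in>F. exp (- s * t i)) \<le> e" by (intro allI impI)
  with I(1,2) show ?thesis by (intro exI[of _ I] exI[of _ x] exI[of _ t] conjI)
qed

section \<open>Comparison with Bowen entropy\<close>

text \<open>Continuity from below. \<open>codable_parse\<close> takes finitely many pieces; the
  points missed become exceptional.\<close>

lemma (in prob_space) finite_subcover_almost:
  fixes U :: "nat \<Rightarrow> 'a set"
  assumes "\<And>i. i \<in> I \<Longrightarrow> U i \<in> sets M" and "prob (\<Union>i\<in>I. U i) = 1" and "0 < \<delta>"
  shows "\<exists>F. finite F \<and> F \<subseteq> I \<and> prob (space M - (\<Union>i\<in>F. U i)) < \<delta>"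
proof -
  define A where "A n = (\<Union>i\<in>I \<inter> {..<n}. U i)" for n
  have A: "A n \<in> sets M" for n unfolding A_def using assms(1) by (intro sets.finite_UN) auto
  have "incseq A" unfolding A_def incseq_def by (intro allI impI UN_mono) auto
  moreover have "(\<Union>n. A n) = (\<Union>i\<in>I. U i)" unfolding A_def by (auto intro: lessI)
  ultimately have "(\<lambda>n. prob (A n)) \<longlonglongrightarrow> 1"
    using finite_Lim_measure_incseq[of A] A assms(2) by auto
  then obtain n where "\<bar>prob (A n) - 1\<bar> < \<delta>"
    using LIMSEQ_D[OF _ assms(3)] by (metis order_refl real_norm_def)
  then have "prob (space M - A n) < \<delta>" using prob_compl[OF A, of n] by linarith
  then show ?thesis unfolding A_def by (intro exI[of _ "I \<inter> {..<n}"]) auto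
qed

text \<open>Inner regularity gives closed cores; compactness of the space puts disjoint cores at
  positive distance, which the cells themselves may lack.\<close>

lemma (in metric_partitioned_system) compact_cores:
  assumes "compact (UNIV :: 'a set)" and M: "sets M = sets borel" and "0 < \<delta>"
  obtains K \<rho> where "0 < \<rho>" "\<And>A. A \<in> P \<Longrightarrow> K A \<subseteq> A"
    "\<And>A B x y. A \<in> P \<Longrightarrow> B \<in> P \<Longrightarrow> A \<noteq> B \<Longrightarrow> x \<in> K A \<Longrightarrow> y \<in> K B \<Longrightarrow> 2 * \<rho> \<le> dist x y"
    "- (\<Union>A\<in>P. K A) \<in> sets M" "prob (- (\<Union>A\<in>P. K A)) \<le> \<delta>"
proof -
  have "\<exists>K. closed K \<and> K \<subseteq> A \<and> prob (A - K) < \<delta> / card P" if "A \<in> P" for A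
    using closed_inner_regular[OF finite_measure_axioms M, of A "\<delta> / card P"] P_sets[OF that] M
      card_P_pos assms(3) by (metis divide_pos_pos)
  then obtain K where K: "\<And>A. A \<in> P \<Longrightarrow> closed (K A)" "\<And>A. A \<in> P \<Longrightarrow> K A \<subseteq> A"
    "\<And>A. A \<in> P \<Longrightarrow> prob (A - K A) < \<delta> / card P" by metis
  have compact: "compact (K A)" if "A \<in> P" for A
    using compact_Int_closed[OF assms(1) K(1)[OF that]] by simp
  have disj: "K A \<inter> K B = {}" if "A \<in> P" "B \<in> P" "A \<noteq> B" for A B
    using P_partition K(2) that unfolding partition_on_def disjoint_def by blast
  have "\<exists>d>0. \<forall>A\<in>P. \<forall>B\<in>P. A \<noteq> B \<longrightarrow> (\<forall>x\<in>K A. \<forall>y\<in>K B. d \<le> dist x y)"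
    by (rule finite_disjoint_compact_dist[of P K, OF finite_P compact disj]) (assumption | blast)+
  then obtain d where d: "0 < d"
    "\<And>A B x y. A \<in> P \<Longrightarrow> B \<in> P \<Longrightarrow> A \<noteq> B \<Longrightarrow> x \<in> K A \<Longrightarrow> y \<in> K B \<Longrightarrow> d \<le> dist x y"
    by meson
  have sets: "A - K A \<in> sets M" if "A \<in> P" for A
    using K(1)[OF that] P_sets[OF that] M by auto
  have "- (\<Union>A\<in>P. K A) \<subseteq> (\<Union>A\<in>P. A - K A)"
    using cell_in in_cell by auto
  then have "prob (- (\<Union>A\<in>P. K A)) \<le> prob (\<Union>A\<in>P. A - K A)"
    using sets by (intro finite_measure_mono) auto
  also have "\<dots> \<le> (\<Sum>A\<in>P. prob (A - K A))"
    using sets by (intro finite_measure_subadditive_finite) auto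
  also have "\<dots> \<le> (\<Sum>A\<in>P. \<delta> / card P)" using K(3) by (intro sum_mono less_imp_le)
  also have "\<dots> = \<delta>" using P_nonempty by simp
  finally have "prob (- (\<Union>A\<in>P. K A)) \<le> \<delta>" .
  moreover have "- (\<Union>A\<in>P. K A) \<in> sets M"
    unfolding M using K(1) by (intro borel_open open_Compl closed_UN) auto
  ultimately show ?thesis using d K(2) by (intro that[of "d / 2" K]) auto
qed

text \<open>\<open>Y\<close> enters only through the open sets containing it, such as the union of a
  cover by balls.\<close>

lemma (in metric_partitioned_system) ks_entropy_partition_le_bowen:
  fixes \<phi> :: "real \<Rightarrow> 'a \<Rightarrow> 'a"
  assumes "compact_metric_flow \<phi>" "without_fixed_points \<phi>" and T: "T = \<phi> 1"
    and M: "sets M = sets borel"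
    and Y: "\<And>U. open U \<Longrightarrow> Y \<subseteq> U \<Longrightarrow> prob U = 1"
    and s: "0 \<le> s" "bowen_outer \<phi> Y s = 0" and \<gamma>: "0 < \<gamma>"
  shows "ks_entropy_partition M T P \<le> s + 5 * \<gamma>"
proof -
  interpret compact_flow \<phi> by unfold_locales fact
  \<comment> \<open>With \<open>1 - \<theta> = exp (- \<gamma>)\<close> a correct guess of the cell
    costs \<gamma>.\<close>
  define \<theta> where "\<theta> = 1 - exp (- \<gamma>)"
  have \<theta>: "0 < \<theta>" "\<theta> < 1" using \<gamma> by (auto simp: \<theta>_def)
  \<comment> \<open>One price for both kinds of exceptional step: naming a cell against the guess
    (\<open>exp_D\<close>) and a single step of the parse outside the balls
    (\<open>D_ge\<close>).\<close>
  define D where "D = ln (2 * real (card P) / \<theta>)"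
  have arg: "2 * real (card P) \<le> 2 * real (card P) / \<theta>"
    using \<theta> card_P_pos by (simp add: field_simps)
  have D_ge: "ln (2 * real (card P)) \<le> D"
    unfolding D_def using arg card_P_pos by (intro ln_mono) auto
  moreover have "0 < ln (2 * real (card P))" using card_P_ge by (intro ln_gt_zero) auto
  ultimately have D0: "0 < D" by linarith
  have exp_D: "exp (- D) \<le> \<theta> / real (card P)"
    using \<theta> card_P_pos unfolding D_def by (simp add: exp_minus field_simps)
  define m where "m = nat \<lceil>ln 3 / \<gamma>\<rceil> + 1"
  have m: "1 \<le> m" "ln 3 \<le> \<gamma> * real m"
  proof -
    have "ln 3 / \<gamma> \<le> real m" unfolding m_def by linarith
    then show "ln 3 \<le> \<gamma> * real m" using \<gamma> by (simp add: field_simps)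
  qed (simp add: m_def)
  obtain K \<rho> where \<rho>: "0 < \<rho>" and K: "\<And>A. A \<in> P \<Longrightarrow> K A \<subseteq> A"
      "\<And>A B x y. A \<in> P \<Longrightarrow> B \<in> P \<Longrightarrow> A \<noteq> B \<Longrightarrow> x \<in> K A \<Longrightarrow> y \<in> K B \<Longrightarrow> 2 * \<rho> \<le> dist x y"
    and E0: "- (\<Union>A\<in>P. K A) \<in> sets M" "prob (- (\<Union>A\<in>P. K A)) \<le> \<gamma> / D"
    using compact_cores[OF compact_space M, of "\<gamma> / D"] \<gamma> D0 by (metis divide_pos_pos)
  define E where "E = - (\<Union>A\<in>P. K A)"
  define g where "g y = \<gamma> + D * indicator E y" for y
  have near: "codable 1 {y. dist z y < \<rho>} g" for z
    unfolding g_def E_def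
    by (rule codable_near[OF K \<theta>]) (use \<gamma> exp_D in \<open>auto simp: \<theta>_def\<close>)
  obtain \<eta> \<epsilon> where \<epsilon>: "0 < \<epsilon>" and shadow: "\<forall>x t k. real (m * k) \<le> t \<longrightarrow>
      rep_ball \<phi> x t \<epsilon> \<subseteq> shadow (\<lambda>x. (\<lambda>b. \<phi> (real m + b * \<eta>) x) ` {-1, 0, 1}) m \<rho> k x"
    using rep_ball_subset_shadow[where m = m, OF assms(1) assms(2) T \<rho>] by (elim exE conjE)
  have card3: "card ((\<lambda>b. \<phi> (real m + b * \<eta>) x) ` {-1, 0, 1}) \<le> 3" for x
    by (rule order_trans[OF card_image_le]) auto
  have cod: "codable (m * k) (rep_ball \<phi> x t \<epsilon>) (\<lambda>y. birkhoff (m * k) g y + real k * ln 3)"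
    if "real (m * k) \<le> t" for x t k
  proof -
    have "codable (m * k) (shadow (\<lambda>x. (\<lambda>b. \<phi> (real m + b * \<eta>) x) ` {-1, 0, 1}) m \<rho> k x)
        (\<lambda>y. birkhoff (m * k) g y + real k * ln (real 3))"
      by (rule codable_shadow[OF near _ card3]) auto
    moreover have sub: "rep_ball \<phi> x t \<epsilon> \<subseteq>
        shadow (\<lambda>x. (\<lambda>b. \<phi> (real m + b * \<eta>) x) ` {-1, 0, 1}) m \<rho> k x"
      using shadow that by blast
    ultimately show ?thesis by (elim codable_mono) (auto dest: subsetD[OF sub])
  qed
  \<comment> \<open>Rounding \<open>t i\<close> down to a multiple of \<open>m\<close> loses less
    than \<open>m\<close>, hence at most \<open>s * m\<close> of the charge. For
    \<open>t i \<ge> N\<close> this is at most \<gamma> times the rounded length, which is then also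
    positive.\<close>
  define N where "N = m + nat \<lceil>s * real m / \<gamma>\<rceil>"
  have N: "real m + s * real m / \<gamma> \<le> real N" unfolding N_def by linarith
  \<comment> \<open>The other half of the total weight goes to the single steps in
    \<open>codable_parse\<close>.\<close>
  have half: "(0::real) < 1 / 2" by simp
  obtain I :: "nat set" and x t where cover: "\<forall>i\<in>I. real N \<le> t i"
    "Y \<subseteq> (\<Union>i\<in>I. rep_ball \<phi> (x i) (t i) \<epsilon>)"
    "\<forall>F. finite F \<longrightarrow> F \<subseteq> I \<longrightarrow> (\<Sum>i\<in>F. exp (- s * t i)) \<le> 1 / 2"
    using bowen_outer_zero_cover[where N = N, OF s(2) \<epsilon> half] by (elim exE conjE)
  have opn: "open (rep_ball \<phi> (x i) (t i) \<epsilon>)" if "i \<in> I" for i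
    using bspec[OF cover(1) that] by (intro open_rep_ball) linarith
  have prob1: "prob (\<Union>i\<in>I. rep_ball \<phi> (x i) (t i) \<epsilon>) = 1"
    by (rule Y[OF open_UN cover(2)]) (use opn in auto)
  have ball_sets: "rep_ball \<phi> (x i) (t i) \<epsilon> \<in> sets M" if "i \<in> I" for i
    unfolding M using opn[OF that] by simp
  have "0 < \<gamma> / D" using \<gamma> D0 by simp
  then have "\<exists>F. finite F \<and> F \<subseteq> I \<and> prob (space M - (\<Union>i\<in>F. rep_ball \<phi> (x i) (t i) \<epsilon>)) < \<gamma> / D"
    by (intro finite_subcover_almost ball_sets prob1)
  then obtain F where F: "finite F" "F \<subseteq> I"
      and F_small: "prob (space M - (\<Union>i\<in>F. rep_ball \<phi> (x i) (t i) \<epsilon>)) < \<gamma> / D"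
    by (elim exE conjE)
  define B where "B = - (\<Union>i\<in>F. rep_ball \<phi> (x i) (t i) \<epsilon>)"
  have B: "B \<in> sets M" "prob B \<le> \<gamma> / D"
  proof -
    have "B = space M - (\<Union>i\<in>F. rep_ball \<phi> (x i) (t i) \<epsilon>)" by (auto simp: B_def)
    moreover have "(\<Union>i\<in>F. rep_ball \<phi> (x i) (t i) \<epsilon>) \<in> sets M"
      using F ball_sets by (intro sets.finite_UN) auto
    ultimately show "B \<in> sets M" "prob B \<le> \<gamma> / D"
      using F_small sets.compl_sets by (simp_all only: less_imp_le)
  qed
  \<comment> \<open>The three \<gamma> pay for the guesses of cells, the \<open>ln 3\<close> per
    block and the rounding of \<open>t i\<close>. The exceptional set has measure at most
    \<open>2 * \<gamma> / D\<close>, so the last term has mean at most \<open>2 * \<gamma>\<close>: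
    in all \<open>s + 5 * \<gamma>\<close>.\<close>
  define g' where "g' y = s + 3 * \<gamma> + D * indicator (E \<union> B) y" for y
  have g'_ge: "s + 2 * \<gamma> + g y \<le> g' y" for y
    unfolding g_def g'_def using D0 by (auto simp: indicator_def)
  define k where "k i = nat \<lfloor>t i / real m\<rfloor>" for i
  have k: "real (m * k i) \<le> t i" "t i < real (m * k i) + real m" "s * t i \<le> (s + \<gamma>) * real (m * k i)"
    "1 \<le> m * k i" if "i \<in> I" for i
  proof -
    have m0: "0 < real m" using m by simp
    have "0 \<le> t i" using bspec[OF cover(1) that] by linarith
    then have "0 \<le> t i / real m" by simp
    then have "real (k i) \<le> t i / real m" "t i / real m < real (k i) + 1" unfolding k_def by linarith+
    then show 1: "real (m * k i) \<le> t i" and 2: "t i < real (m * k i) + real m"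
      using m0 by (auto simp: field_simps)
    have "s * real m / \<gamma> \<le> real (m * k i)" using 2 N bspec[OF cover(1) that] by linarith
    then have "s * real m \<le> \<gamma> * real (m * k i)" using \<gamma> by (simp only: pos_divide_le_eq mult.commute)
    moreover have "s * t i \<le> s * (real (m * k i) + real m)" using 2 s(1) by (intro mult_left_mono) auto
    ultimately show "s * t i \<le> (s + \<gamma>) * real (m * k i)" by (simp only: distrib_left distrib_right)
    have "0 \<le> s * real m / \<gamma>" using s(1) \<gamma> by simp
    then have "0 < real (m * k i)" using 2 N bspec[OF cover(1) that] by linarith
    then show "1 \<le> m * k i" by linarith
  qed
  have sum_half: "(\<Sum>i\<in>F. exp (- s * t i)) \<le> 1 / 2" using cover(3) F by blast
  obtain C where C: "\<And>n. codable n (space M) (\<lambda>y. birkhoff n g' y + C)"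
  proof (rule codable_parse[OF F(1), where m = "\<lambda>i. m * k i" and G = "\<lambda>i. rep_ball \<phi> (x i) (t i) \<epsilon>"
        and w = "\<lambda>i. exp (- s * t i)" and g = g'])
    fix i assume "i \<in> F"
    then have i: "i \<in> I" using F by auto
    show "1 \<le> m * k i" by (rule k(4)[OF i])
    show "codable (m * k i) (rep_ball \<phi> (x i) (t i) \<epsilon>)
        (\<lambda>y. birkhoff (m * k i) g' y + ln (exp (- s * t i)))"
    proof (rule codable_mono[OF cod[OF k(1)[OF i]]], intro conjI)
      fix y
      have "real (m * k i) * (s + 2 * \<gamma>) + birkhoff (m * k i) g y
          = (\<Sum>j<m * k i. s + 2 * \<gamma> + g ((T ^^ j) y))"
        by (simp add: birkhoff_def sum.distrib)
      also have "\<dots> \<le> birkhoff (m * k i) g' y"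
        unfolding birkhoff_def by (intro sum_mono g'_ge)
      finally have "real (m * k i) * (s + 2 * \<gamma>) + birkhoff (m * k i) g y \<le> birkhoff (m * k i) g' y" .
      moreover have "real (k i) * ln 3 \<le> real (k i) * (\<gamma> * real m)"
        using m(2) by (intro mult_left_mono) auto
      moreover have "real (k i) * (\<gamma> * real m) = \<gamma> * real (m * k i)" by simp
      moreover have "real (m * k i) * (s + 2 * \<gamma>) = (s + \<gamma>) * real (m * k i) + \<gamma> * real (m * k i)"
        by (simp add: algebra_simps)
      moreover have "ln (exp (- s * t i)) = - (s * t i)" by simp
      ultimately show "birkhoff (m * k i) g y + real (k i) * ln 3
          \<le> birkhoff (m * k i) g' y + ln (exp (- s * t i))"
        using k(3)[OF i] by linarith
    qed
  next
    fix y
    show "0 \<le> g' y" unfolding g'_def using s(1) \<gamma> D0 by (simp add: indicator_def)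
    assume "y \<notin> (\<Union>i\<in>F. rep_ball \<phi> (x i) (t i) \<epsilon>)"
    then have "y \<in> E \<union> B" by (simp add: B_def)
    then show "ln (2 * real (card P)) \<le> g' y" unfolding g'_def using s(1) \<gamma> D_ge by simp
  qed (use sum_half in auto)
  have EB: "E \<union> B \<in> sets M" using E0(1) B(1) by (simp add: E_def)
  have "prob (E \<union> B) \<le> prob E + prob B"
    using E0(1) B(1) unfolding E_def by (intro measure_Un_le) auto
  also have "\<dots> \<le> \<gamma> / D + \<gamma> / D" using E0(2) B(2) unfolding E_def by (rule add_mono)
  finally have "D * prob (E \<union> B) \<le> D * (\<gamma> / D + \<gamma> / D)" using D0 by (intro mult_left_mono) auto
  also have "\<dots> = 2 * \<gamma>" using D0 by (simp add: field_simps)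
  finally have small: "D * prob (E \<union> B) \<le> 2 * \<gamma>" .
  have ind: "integrable M (\<lambda>y. D * indicator (E \<union> B) y)"
    using EB by (intro integrable_mult_right integrable_real_indicator) (auto simp: less_top[symmetric])
  have int: "integrable M g'"
    unfolding g'_def using ind by (intro Bochner_Integration.integrable_add integrable_const)
  have "(\<integral>y. g' y \<partial>M) = s + 3 * \<gamma> + D * prob (E \<union> B)"
    unfolding g'_def using ind EB by (subst Bochner_Integration.integral_add) auto
  then have mean: "(\<integral>y. g' y \<partial>M) \<le> s + 5 * \<gamma>" using small by simp
  show ?thesis
  proof (rule ks_entropy_partition_le)
    fix n
    have "block_entropy n \<le> (\<integral>y. birkhoff n g' y + C \<partial>M)"
      using integral_birkhoff(1)[OF int, of n] by (intro block_entropy_le[OF C]) auto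
    also have "\<dots> = real n * (\<integral>y. g' y \<partial>M) + C"
      using integral_birkhoff[OF int, of n] by simp
    also have "\<dots> \<le> real n * (s + 5 * \<gamma>) + C" using mean by (simp add: mult_left_mono)
    finally show "block_entropy n \<le> (s + 5 * \<gamma>) * real n + C" by (simp add: mult.commute)
  qed
qed

theorem theorem1p2:
  fixes \<phi> :: "real \<Rightarrow> 'a::metric_space \<Rightarrow> 'a"
    and \<mu> :: "'a measure"
    and Y :: "'a set"
  assumes "compact_metric_flow \<phi>"
    and "without_fixed_points \<phi>"
    and "\<mu> \<in> invariant_prob_measures \<phi>"
    and "Y \<in> sets (completion \<mu>)"
    and "emeasure (completion \<mu>) Y = 1"
  shows "ks_entropy \<mu> (\<phi> 1) \<le> bowen_entropy \<phi> Y"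
proof -
  interpret compact_flow \<phi> by unfold_locales fact
  have "prob_space \<mu>" and sets: "sets \<mu> = sets borel"
    and inv: "\<And>B t. B \<in> sets borel \<Longrightarrow> emeasure \<mu> (\<phi> t ` B) = emeasure \<mu> B"
    using assms(3) by (auto simp: invariant_prob_measures_def)
  interpret prob_space \<mu> by fact
  have space: "space \<mu> = UNIV" using sets_eq_imp_space_eq[OF sets] by simp
  have meas: "\<phi> 1 \<in> measurable \<mu> \<mu>"
    unfolding measurable_cong_sets[OF sets sets]
    by (rule borel_measurable_continuous_onI[OF flow_continuous_on])
  have pres: "distr \<mu> \<mu> (\<phi> 1) = \<mu>"
  proof (rule measure_eqI)
    fix B assume "B \<in> sets (distr \<mu> \<mu> (\<phi> 1))"
    then have B: "B \<in> sets \<mu>" by simp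
    \<comment> \<open>Invariance is phrased with images; a preimage under the time-one map is an
      image under its inverse.\<close>
    have "\<phi> 1 -` B = \<phi> (- 1) ` B"
    proof (intro equalityI subsetI)
      fix y assume "y \<in> \<phi> 1 -` B"
      then show "y \<in> \<phi> (- 1) ` B" by (intro image_eqI[of _ _ "\<phi> 1 y"]) (auto simp: flow_add)
    qed (auto simp: flow_add)
    then show "emeasure (distr \<mu> \<mu> (\<phi> 1)) B = emeasure \<mu> B"
      using B inv[of B "- 1"] sets by (simp add: emeasure_distr[OF meas B] space)
  qed simp
  \<comment> \<open>\<open>Y\<close> is only known to be measurable for the completion, but an open
    set containing it is Borel and has the same measure for \<mu>.\<close>
  have open_prob: "prob U = 1" if U: "open U" "Y \<subseteq> U" for U
  proof -
    have Us: "U \<in> sets \<mu>" unfolding sets using U by simp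
    have "emeasure (completion \<mu>) Y \<le> emeasure (completion \<mu>) U"
      by (rule emeasure_mono[OF U(2)]) (use Us in auto)
    then have "1 \<le> emeasure \<mu> U" using assms(5) Us by simp
    then have "1 \<le> prob U" by (simp add: emeasure_eq_measure)
    then show ?thesis by (simp add: antisym prob_le_1)
  qed
  show ?thesis
    unfolding ks_entropy_def bowen_entropy_def
  proof (intro SUP_least Inf_greatest)
    fix P v
    assume P: "P \<in> finite_measurable_partitions \<mu>"
      and "v \<in> {ereal s | s. 0 \<le> s \<and> bowen_outer \<phi> Y s = 0}"
    then obtain s where s: "v = ereal s" "0 \<le> s" "bowen_outer \<phi> Y s = 0" by auto
    interpret metric_partitioned_system \<mu> "\<phi> 1" P
      by unfold_locales (use meas pres P space in auto)
    have "ks_entropy_partition \<mu> (\<phi> 1) P \<le> s"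
    proof (rule field_le_epsilon)
      fix e :: real assume "0 < e"
      then have "ks_entropy_partition \<mu> (\<phi> 1) P \<le> s + 5 * (e / 5)"
        by (intro ks_entropy_partition_le_bowen[OF assms(1,2) refl sets open_prob s(2,3)]) auto
      then show "ks_entropy_partition \<mu> (\<phi> 1) P \<le> s + e" by simp
    qed
    then show "ereal (ks_entropy_partition \<mu> (\<phi> 1) P) \<le> v" using s(1) by simp
  qed
qed

end
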